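(* The following completeness results hold. (1) $\mathcal{S}\mathsf{K}_{\omega_1}$ is complete for the class of all Kripke models. (2) $\mathcal{S}\mathsf{K4}_{\omega_1}$ is complete for the class of transitive Kripke models. (3) $\mathcal{S}\mathsf{GL}^{\infty}_{\omega_1}$ is complete for the class of transitive and conversely well-founded Kripke models. Here a calculus $\mathsf{T}$ is complete for a class $\mathfrak{M}$ of Kripke models if for every nested sequent $\Gamma$: if $\mathcal{K}\models\Gamma$ for every $\mathcal{K}\in\mathfrak{M}$ supporting $\Gamma$, then $\mathsf{T}\vdash\Gamma$.
   Context: **Language.** Fix a set of atoms. Formulas of the infinitary modal language $\mathcal{L}^{\Box}_{\omega_1}$ are generated inductively by $A::=p\mid\overline{p}\mid\bigwedge X\mid\bigvee X\mid\Box A\mid\lozenge A$, with $p$ an atom and $X$ a countable (possibly finite or empty) set of formulas. Negation is defined by $\neg p=\overline p$, $\neg\overline p=p$, $\neg\bigwedge X=\bigvee\{\neg A:A\in X\}$, $\neg\bigvee X=\bigwedge\{\neg A:A\in X\}$, $\neg\Box A=\lozenge\neg A$, $\neg\lozenge A=\Box\neg A$; $\top=\bigwedge\emptyset$, $\bot=\bigvee\emptyset$. **Nested sequents.** By simultaneous induction: a nested sequent is a finite multiset of nested formulas; a nested formula is either an $\mathcal{L}^{\Box}_{\omega_1}$-formula or $[\Gamma]$ with $\Gamma$ a non-empty nested sequent. Comma denotes multiset union, and $A$ also denotes the sequent $\{A\}$. The syntax-tree of $\Gamma$ has a root whose children correspond to the members of $\Gamma$ (with multiplicity): a formula gives a leaf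 labelled by it, and $[\Theta]$ gives a bracket node whose children correspond in the same way to the members of $\Theta$, and so on. An occurrence in $\Gamma$ is the root or a bracket node of this tree; it is an occurrence of the nested sequent formed by its children. An occurrence is a sub-occurrence of another if it is equal to it or a descendant of it in the tree. $\Gamma\{\Delta\}$ denotes a nested sequent with a designated occurrence of $\Delta$ (so $\Delta$ is the whole sequent or the whole content of a bracket), and $\Gamma\{\Delta'\}$ is the result of replacing it by $\Delta'$. **Rules.** ($\neg$) axiom $\Gamma\{\Delta,p,\overline p\}$, $p$ an atom; ($\wedge$) from $\Gamma\{\Delta,\bigwedge X,A\}$ for all $A\in X$ infer $\Gamma\{\Delta,\bigwedge X\}$ (for $X=\emptyset$ this is the axiom $\Gamma\{\Delta,\top\}$, called the $\top$-axiom); ($\vee$) from $\Gamma\{\Delta,\bigvee X,A\}$, for one $A\in X$, infer $\Gamma\{\Delta,\bigvee X\}$; ($\lozenge$) from $\Gamma\{\Delta,[\Theta,A,\lozenge A],\lozenge A\}$ infer $\Gamma\{\Delta,[\Theta],\lozenge A\}$; (w$\lozenge$) from $\Gamma\{\Delta,[\Theta,A],\lozenge A\}$ infer $\Gamma\{\Delta,[\Theta],\lozenge A\}$; ($\Box$) from $\Gamma\{\Delta,[A],\Box A\}$ infer $\Gamma\{\Delta,\Box A\}$. A partial proof-tree over a set of rules is a rooted tree (possibly infinitely branching and with infinite branches; each node has finitely many predecessors) labelled by nested sequents, where each non-leaf label follows from the labels of its children (the nodes immediately above it) by one of the rules. It is well-founded if it has no infinite branch. Going upwards, rules only add nodes to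 syntax-trees, so every occurrence in a sequent is also regarded as an occurrence in all sequents above it. **Calculi.** A proof in any of the calculi is a partial proof-tree all of whose leaves are instances of the $\neg$-axiom or $\top$-axiom, subject to: - $\mathcal{S}\mathsf{K4}_{\omega_1}$: rules $\neg,\wedge,\vee,\lozenge,\Box$; the tree is well-founded. - $\mathcal{S}\mathsf{K}_{\omega_1}$: rules $\neg,\wedge,\vee,$ w$\lozenge,\Box$; the tree is well-founded. - $\mathcal{S}\mathsf{GL}^{\infty}_{\omega_1}$: rules $\neg,\wedge,\vee,\lozenge,\Box$; every infinite branch includes infinitely many instances of $\Box$-rules, each of them nested in the previous one. Here, if an instance $D_1$ of the $\Box$-rule, inferring $\Gamma'\{\Theta',\Box A'\}$ from $\Gamma'\{\Theta',[A'],\Box A'\}$, appears above an instance $D_0$ inferring $\Gamma\{\Theta,\Box A\}$ from $\Gamma\{\Theta,[A],\Box A\}$, then $D_1$ is nested in $D_0$ if the designated occurrence of $\Theta',\Box A'$ in the conclusion of $D_1$ is a sub-occurrence of the bracket $[A]$ created by $D_0$. $\mathsf{T}\vdash\Gamma$ means that $\Gamma$ labels the root of a $\mathsf{T}$-proof. **Kripke models.** A Kripke model is $\mathcal{K}=(W,\sqsubset,\mathrel{E},S)$ with $\sqsubset$ a binary relation on $W$, $S$ a set of atoms, and $E\subseteq W\times S$. It supports a formula or sequent if all atoms occurring in it are in $S$. Satisfaction: $w\models p$ iff $w\mathrel{E}p$; $w\models\overline p$ iff $w\not\models p$; $w\models\bigwedge X$ iff $w\models A$ for all $A\in X$; $w\models\bigvee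 X$ iff $w\models A$ for some $A\in X$; $w\models\Box A$ iff $u\models A$ for all $u\sqsupset w$; $w\models\lozenge A$ iff $u\models A$ for some $u\sqsupset w$; for sequents, $w\models\Gamma$ iff $w\models A$ for some $A\in\Gamma$, and $w\models[\Gamma]$ iff $u\models\Gamma$ for all $u\sqsupset w$. $\mathcal{K}\models\Gamma$ means $\mathcal{K},w\models\Gamma$ for all $w\in W$. $\mathcal{K}$ is transitive (conversely well-founded) iff $(W,\sqsubset)$ is. *)

theory Defs
  imports Main "HOL-Library.Multiset" "HOL-Library.Countable_Set_Type"
begin

section \<open>Formulas and nested sequents\<close>

datatype (atoms_form: 'a) form =
    Atom 'a
  | NegAtom 'a
  | Conj "'a form cset"
  | Disj "'a form cset"
  | Box "'a form"
  | Dia "'a form"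

text \<open>Elements of the following type may contain empty brackets; these are excluded by
  \<open>nested_formula\<close> and \<open>nested_sequent\<close>.\<close>

datatype (atoms_nform: 'a) nform = Fm "'a form" | Br "'a nform multiset"

type_synonym 'a sequent = "'a nform multiset"

inductive nested_formula :: "'a nform \<Rightarrow> bool" where
  "nested_formula (Fm A)"
| "\<Gamma> \<noteq> {#} \<Longrightarrow> \<forall>x \<in> set_mset \<Gamma>. nested_formula x \<Longrightarrow> nested_formula (Br \<Gamma>)"

definition nested_sequent :: "'a sequent \<Rightarrow> bool" where
  "nested_sequent \<Gamma> \<longleftrightarrow> (\<forall>x \<in># \<Gamma>. nested_formula x)"

definition atoms_sequent :: "'a sequent \<Rightarrow> 'a set" where
  "atoms_sequent \<Gamma> = (\<Union>x \<in> set_mset \<Gamma>. atoms_nform x)"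


section \<open>Kripke models\<close>

record ('w, 'a) kripke =
  worlds :: "'w set"
  acc :: "('w \<times> 'w) set"
  dom_atoms :: "'a set"
  val :: "('w \<times> 'a) set"

definition kripke_model :: "('w, 'a) kripke \<Rightarrow> bool" where
  "kripke_model K \<longleftrightarrow>
     acc K \<subseteq> worlds K \<times> worlds K \<and> val K \<subseteq> worlds K \<times> dom_atoms K"

definition supports :: "('w, 'a) kripke \<Rightarrow> 'a sequent \<Rightarrow> bool" where
  "supports K \<Gamma> \<longleftrightarrow> atoms_sequent \<Gamma> \<subseteq> dom_atoms K"

text \<open>In the recursive equations below the satisfaction predicates of the members of a
  set or multiset are collected with the map function of the type constructor, as primitive
  recursion requires; the lemmas \<open>sat_Conj\<close>, \<open>sat_Disj\<close> and \<open>nsat_Br\<close> give the usual clauses.\<close>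

primrec sat :: "('w, 'a) kripke \<Rightarrow> 'a form \<Rightarrow> 'w \<Rightarrow> bool" where
  "sat K (Atom p) w \<longleftrightarrow> (w, p) \<in> val K"
| "sat K (NegAtom p) w \<longleftrightarrow> (w, p) \<notin> val K"
| "sat K (Conj X) w \<longleftrightarrow> (\<forall>f \<in> rcset (cimage (sat K) X). f w)"
| "sat K (Disj X) w \<longleftrightarrow> (\<exists>f \<in> rcset (cimage (sat K) X). f w)"
| "sat K (Box A) w \<longleftrightarrow> (\<forall>u. (w, u) \<in> acc K \<longrightarrow> sat K A u)"
| "sat K (Dia A) w \<longleftrightarrow> (\<exists>u. (w, u) \<in> acc K \<and> sat K A u)"

lemma sat_Conj: "sat K (Conj X) w \<longleftrightarrow> (\<forall>A \<in> rcset X. sat K A w)"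
  by (simp add: cimage.rep_eq)

lemma sat_Disj: "sat K (Disj X) w \<longleftrightarrow> (\<exists>A \<in> rcset X. sat K A w)"
  by (simp add: cimage.rep_eq)

primrec nsat :: "('w, 'a) kripke \<Rightarrow> 'a nform \<Rightarrow> 'w \<Rightarrow> bool" where
  "nsat K (Fm A) w \<longleftrightarrow> sat K A w"
| "nsat K (Br \<Gamma>) w \<longleftrightarrow>
     (\<forall>u. (w, u) \<in> acc K \<longrightarrow> (\<exists>f \<in># image_mset (nsat K) \<Gamma>. f u))"

definition sat_sequent :: "('w, 'a) kripke \<Rightarrow> 'a sequent \<Rightarrow> 'w \<Rightarrow> bool" where
  "sat_sequent K \<Gamma> w \<longleftrightarrow> (\<exists>x \<in># \<Gamma>. nsat K x w)"

lemma nsat_Br: "nsat K (Br \<Gamma>) w \<longleftrightarrow> (\<forall>u. (w, u) \<in> acc K \<longrightarrow> sat_sequent K \<Gamma> u)"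
  by (simp add: sat_sequent_def)

definition valid_in :: "('w, 'a) kripke \<Rightarrow> 'a sequent \<Rightarrow> bool" where
  "valid_in K \<Gamma> \<longleftrightarrow> (\<forall>w \<in> worlds K. sat_sequent K \<Gamma> w)"

definition all_models :: "('w, 'a) kripke set" where
  "all_models = {K. kripke_model K}"

definition transitive_models :: "('w, 'a) kripke set" where
  "transitive_models = {K. kripke_model K \<and> trans (acc K)}"

definition transitive_cwf_models :: "('w, 'a) kripke set" where
  "transitive_cwf_models = {K. kripke_model K \<and> trans (acc K) \<and> wf ((acc K)\<inverse>)}"


section \<open>Syntax-trees\<close>

text \<open>A multiset does not distinguish equal members, so the identity of an occurrence in a
  sequent and in the sequents above it has to be recorded. The syntax-tree of a sequent is
  therefore represented with a name on every bracket node, distinct nodes having distinct names.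
  The rules below keep these names, and the \<open>\<box>\<close>-rule gives a fresh one to the bracket it
  creates. An occurrence is thus either the root or the name of a bracket. Forgetting the names
  (\<open>erase\<close>) yields the nested sequent.\<close>

datatype 'a tform = TFm "'a form" | TBr nat "'a tform multiset"

type_synonym 'a tsequent = "'a tform multiset"

primrec erase_tform :: "'a tform \<Rightarrow> 'a nform" where
  "erase_tform (TFm A) = Fm A"
| "erase_tform (TBr i \<Gamma>) = Br (image_mset erase_tform \<Gamma>)"

definition erase :: "'a tsequent \<Rightarrow> 'a sequent" where
  "erase \<Gamma> = image_mset erase_tform \<Gamma>"

primrec names_tform :: "'a tform \<Rightarrow> nat multiset" where
  "names_tform (TFm A) = {#}"
| "names_tform (TBr i \<Gamma>) = add_mset i (\<Sum>\<^sub># (image_mset names_tform \<Gamma>))"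

definition names :: "'a tsequent \<Rightarrow> nat multiset" where
  "names \<Gamma> = \<Sum>\<^sub># (image_mset names_tform \<Gamma>)"

definition syntax_tree :: "'a tsequent \<Rightarrow> bool" where
  "syntax_tree \<Gamma> \<longleftrightarrow> nested_sequent (erase \<Gamma>) \<and> (\<forall>i. count (names \<Gamma>) i \<le> 1)"

text \<open>A context is a sequent with a hole for the content of the root or of a bracket;
  \<open>In \<Sigma> i C\<close> is \<open>\<Sigma>, [C]\<close> with the displayed bracket named \<open>i\<close>.\<close>

datatype 'a ctxt = Hole | In "'a tsequent" nat "'a ctxt"

primrec fill :: "'a ctxt \<Rightarrow> 'a tsequent \<Rightarrow> 'a tsequent" where
  "fill Hole \<Delta> = \<Delta>"
| "fill (In \<Sigma> i C) \<Delta> = \<Sigma> + {# TBr i (fill C \<Delta>) #}"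

text \<open>The names of the brackets enclosing the hole. As names are unique, the designated
  occurrence in \<open>fill C \<Delta>\<close> is a sub-occurrence of the bracket named \<open>i\<close> iff
  \<open>i \<in> set (hole_path C)\<close>.\<close>

primrec hole_path :: "'a ctxt \<Rightarrow> nat list" where
  "hole_path Hole = []"
| "hole_path (In \<Sigma> i C) = i # hole_path C"


section \<open>Rules and proof-trees\<close>

datatype rule = NegR | AndR | OrR | DiaR | WDiaR | BoxR

definition box_instance :: "'a ctxt \<Rightarrow> nat \<Rightarrow> 'a tsequent \<Rightarrow> 'a tsequent \<Rightarrow> bool" where
  "box_instance C i premise conclusion \<longleftrightarrow>
     (\<exists>\<Delta> A. conclusion = fill C (\<Delta> + {# TFm (Box A) #}) \<and>
             premise = fill C (\<Delta> + {# TBr i {# TFm A #}, TFm (Box A) #}) \<and>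
             i \<notin># names conclusion)"

text \<open>\<open>rule_instance r P \<Gamma>\<close>: the rule \<open>r\<close> infers \<open>\<Gamma>\<close> from the premises \<open>P\<close>.\<close>

inductive rule_instance :: "rule \<Rightarrow> 'a tsequent set \<Rightarrow> 'a tsequent \<Rightarrow> bool" where
  "rule_instance NegR {} (fill C (\<Delta> + {# TFm (Atom p), TFm (NegAtom p) #}))"
| "rule_instance AndR {fill C (\<Delta> + {# TFm (Conj X), TFm A #}) | A. A \<in> rcset X}
     (fill C (\<Delta> + {# TFm (Conj X) #}))"
| "A \<in> rcset X \<Longrightarrow>
   rule_instance OrR {fill C (\<Delta> + {# TFm (Disj X), TFm A #})}
     (fill C (\<Delta> + {# TFm (Disj X) #}))"
| "rule_instance DiaR
     {fill C (\<Delta> + {# TBr i (\<Theta> + {# TFm A, TFm (Dia A) #}), TFm (Dia A) #})}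
     (fill C (\<Delta> + {# TBr i \<Theta>, TFm (Dia A) #}))"
| "rule_instance WDiaR
     {fill C (\<Delta> + {# TBr i (\<Theta> + {# TFm A #}), TFm (Dia A) #})}
     (fill C (\<Delta> + {# TBr i \<Theta>, TFm (Dia A) #}))"
| "box_instance C i \<Gamma>' \<Gamma> \<Longrightarrow> rule_instance BoxR {\<Gamma>'} \<Gamma>"

text \<open>The \<open>\<top>\<close>-axiom is the \<open>\<and>\<close>-rule for the empty conjunction, i.e. without premises.\<close>

definition is_axiom :: "'a tsequent \<Rightarrow> bool" where
  "is_axiom \<Gamma> \<longleftrightarrow> rule_instance NegR {} \<Gamma> \<or> rule_instance AndR {} \<Gamma>"

codatatype 'a tree = Tree (label: "'a tsequent") (children: "'a tree cset")

inductive_set nodes :: "'a tree \<Rightarrow> 'a tree set" for t where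
  "t \<in> nodes t"
| "u \<in> nodes t \<Longrightarrow> v \<in> rcset (children u) \<Longrightarrow> v \<in> nodes t"

text \<open>The children of a node carry distinct labels, one for each premise of the rule.\<close>

definition partial_proof_tree :: "rule set \<Rightarrow> 'a tree \<Rightarrow> bool" where
  "partial_proof_tree R t \<longleftrightarrow>
     (\<forall>u \<in> nodes t. syntax_tree (label u) \<and>
        (rcset (children u) \<noteq> {} \<longrightarrow>
           (\<exists>r \<in> R. \<exists>P. rule_instance r P (label u) \<and>
                        bij_betw label (rcset (children u)) P)))"

definition axiomatic_leaves :: "'a tree \<Rightarrow> bool" where
  "axiomatic_leaves t \<longleftrightarrow>
     (\<forall>u \<in> nodes t. rcset (children u) = {} \<longrightarrow> is_axiom (label u))"

definition infinite_branch :: "'a tree \<Rightarrow> (nat \<Rightarrow> 'a tree) \<Rightarrow> bool" where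
  "infinite_branch t b \<longleftrightarrow> b 0 = t \<and> (\<forall>n. b (Suc n) \<in> rcset (children (b n)))"

definition well_founded_tree :: "'a tree \<Rightarrow> bool" where
  "well_founded_tree t \<longleftrightarrow> (\<nexists>b. infinite_branch t b)"

text \<open>The step from \<open>b (g k)\<close> to \<open>b (Suc (g k))\<close> is the \<open>k\<close>-th of the selected instances of the
  \<open>\<box>\<close>-rule; it creates the bracket named \<open>i k\<close>, and the designated occurrence in the
  conclusion of the next one lies in that bracket. Nodes need not record which rule was applied:
  only the \<open>\<box>\<close>-rule creates a bracket, so its instances, with their designated occurrences, can
  be recognised from the two labels.\<close>

definition progressing_branch :: "(nat \<Rightarrow> 'a tree) \<Rightarrow> bool" where
  "progressing_branch b \<longleftrightarrow>
     (\<exists>g C i. strict_mono (g :: nat \<Rightarrow> nat) \<and>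
        (\<forall>k. box_instance (C k) (i k) (label (b (Suc (g k)))) (label (b (g k))) \<and>
             i k \<in> set (hole_path (C (Suc k)))))"

definition SK4_provable :: "'a sequent \<Rightarrow> bool" where
  "SK4_provable \<Gamma> \<longleftrightarrow>
     (\<exists>t. erase (label t) = \<Gamma> \<and> partial_proof_tree {NegR, AndR, OrR, DiaR, BoxR} t \<and>
          axiomatic_leaves t \<and> well_founded_tree t)"

definition SK_provable :: "'a sequent \<Rightarrow> bool" where
  "SK_provable \<Gamma> \<longleftrightarrow>
     (\<exists>t. erase (label t) = \<Gamma> \<and> partial_proof_tree {NegR, AndR, OrR, WDiaR, BoxR} t \<and>
          axiomatic_leaves t \<and> well_founded_tree t)"

definition SGL_provable :: "'a sequent \<Rightarrow> bool" where
  "SGL_provable \<Gamma> \<longleftrightarrow>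
     (\<exists>t. erase (label t) = \<Gamma> \<and> partial_proof_tree {NegR, AndR, OrR, DiaR, BoxR} t \<and>
          axiomatic_leaves t \<and> (\<forall>b. infinite_branch t b \<longrightarrow> progressing_branch b))"

text \<open>Models have their worlds in a type \<open>'w\<close>, over which HOL cannot quantify inside a formula.
  The smaller \<open>'w\<close> is, the weaker is the assumption on \<open>\<Gamma>\<close> and the stronger is completeness, so
  completeness for one type \<open>'w\<close> implies it for models of every size. It can fail for a finite
  \<open>'w\<close>, as countermodels may have to be infinite.\<close>

definition complete_for :: "('a sequent \<Rightarrow> bool) \<Rightarrow> ('w, 'a) kripke set \<Rightarrow> bool" where
  "complete_for T M \<longleftrightarrow>
     (\<forall>\<Gamma>. nested_sequent \<Gamma> \<longrightarrow> (\<forall>K \<in> M. supports K \<Gamma> \<longrightarrow> valid_in K \<Gamma>) \<longrightarrow> T \<Gamma>)"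

end

theory Submission imports Defs begin

text \<open>Proof search which always reduces the unfulfilled requirement of least code (the root
  sequent has only countably many subformulas) depends only on the current sequent and is fair.
  The limit of an infinite branch, like a leaf where nothing remains to be reduced, is therefore
  a refutation: its occurrences, with the bracket structure or its transitive closure as
  accessibility, form a countermodel. If the accessibility relation of the limit is not conversely
  well-founded, then it contains an infinite path of brackets, and the instances of the
  \<open>\<box>\<close>-rule creating them show that the branch is progressing.\<close>

section \<open>Positions in syntax-trees\<close>

text \<open>One search serves all three calculi. Its tree always exists, and what is shown is only
  that each non-axiomatic leaf and each infinite branch yields a refutation. Validity then excludes
  the ones that matter: all infinite branches for K and K4, only the non-progressing ones for GL.
  The obstacle is that rules act on multisets inside contexts, whereas a limit needs increasing
  sets. Each sequent is therefore read as two sets, its formulas with their positions and the edges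
  between positions. Both grow along a branch, and uniqueness of names leads back from them to a
  context displaying the member that a rule needs. Names are chosen so that positions increase along
  edges; this keeps finite trees acyclic and forces an infinite path to leave the brackets of the
  root sequent.\<close>

text \<open>The root has position \<open>0\<close>, the bracket named \<open>i\<close> has position \<open>Suc i\<close>. The functions
  below take the position of the enclosing occurrence as an argument.\<close>

primrec forms_tform :: "'a tform \<Rightarrow> nat \<Rightarrow> (nat \<times> 'a form) set" where
  "forms_tform (TFm A) w = {(w, A)}"
| "forms_tform (TBr i \<Gamma>) w = (\<Union>f \<in> set_mset (image_mset forms_tform \<Gamma>). f (Suc i))"

definition forms_at :: "nat \<Rightarrow> 'a tsequent \<Rightarrow> (nat \<times> 'a form) set" where
  "forms_at w \<Gamma> = (\<Union>x \<in> set_mset \<Gamma>. forms_tform x w)"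

primrec edges_tform :: "'a tform \<Rightarrow> nat \<Rightarrow> (nat \<times> nat) set" where
  "edges_tform (TFm A) w = {}"
| "edges_tform (TBr i \<Gamma>) w =
     insert (w, Suc i) (\<Union>f \<in> set_mset (image_mset edges_tform \<Gamma>). f (Suc i))"

definition edges_at :: "nat \<Rightarrow> 'a tsequent \<Rightarrow> (nat \<times> nat) set" where
  "edges_at w \<Gamma> = (\<Union>x \<in> set_mset \<Gamma>. edges_tform x w)"

primrec pos_from :: "nat \<Rightarrow> 'a ctxt \<Rightarrow> nat" where
  "pos_from w Hole = w"
| "pos_from w (In \<Sigma> i C) = pos_from (Suc i) C"

lemma forms_tform_TBr [simp]: "forms_tform (TBr i \<Gamma>) w = forms_at (Suc i) \<Gamma>"
  by (simp add: forms_at_def)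

lemma edges_tform_TBr [simp]: "edges_tform (TBr i \<Gamma>) w = insert (w, Suc i) (edges_at (Suc i) \<Gamma>)"
  by (simp add: edges_at_def)

lemma names_tform_TBr [simp]: "names_tform (TBr i \<Gamma>) = add_mset i (names \<Gamma>)"
  by (simp add: names_def)

lemma erase_tform_TBr [simp]: "erase_tform (TBr i \<Gamma>) = Br (erase \<Gamma>)"
  by (simp add: erase_def)

declare forms_tform.simps(2) [simp del] edges_tform.simps(2) [simp del]
  names_tform.simps(2) [simp del] erase_tform.simps(2) [simp del]

lemma forms_at_simps [simp]:
  "forms_at w {#} = {}"
  "forms_at w (add_mset x \<Gamma>) = forms_tform x w \<union> forms_at w \<Gamma>"
  "forms_at w (\<Gamma> + \<Delta>) = forms_at w \<Gamma> \<union> forms_at w \<Delta>"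
  by (auto simp: forms_at_def)

lemma edges_at_simps [simp]:
  "edges_at w {#} = {}"
  "edges_at w (add_mset x \<Gamma>) = edges_tform x w \<union> edges_at w \<Gamma>"
  "edges_at w (\<Gamma> + \<Delta>) = edges_at w \<Gamma> \<union> edges_at w \<Delta>"
  by (auto simp: edges_at_def)

lemma names_simps [simp]:
  "names {#} = {#}"
  "names (add_mset x \<Gamma>) = names_tform x + names \<Gamma>"
  "names (\<Gamma> + \<Delta>) = names \<Gamma> + names \<Delta>"
  by (auto simp: names_def)

lemma erase_simps [simp]:
  "erase {#} = {#}"
  "erase (add_mset x \<Gamma>) = add_mset (erase_tform x) (erase \<Gamma>)"
  "erase (\<Gamma> + \<Delta>) = erase \<Gamma> + erase \<Delta>"
  "erase \<Gamma> = {#} \<longleftrightarrow> \<Gamma> = {#}"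
  by (auto simp: erase_def)

lemma nested_sequent_simps [simp]:
  "nested_sequent {#}"
  "nested_sequent (add_mset x \<Gamma>) \<longleftrightarrow> nested_formula x \<and> nested_sequent \<Gamma>"
  "nested_sequent (\<Gamma> + \<Delta>) \<longleftrightarrow> nested_sequent \<Gamma> \<and> nested_sequent \<Delta>"
  by (auto simp: nested_sequent_def)

lemma nested_formula_simps [simp]:
  "nested_formula (Fm A)"
  "nested_formula (Br \<Gamma>) \<longleftrightarrow> \<Gamma> \<noteq> {#} \<and> nested_sequent \<Gamma>"
  by (auto simp: nested_formula.simps[of "Fm A"] nested_formula.simps[of "Br \<Gamma>"]
      nested_sequent_def)

lemma set_names: "set_mset (names \<Gamma>) = (\<Union>x \<in> set_mset \<Gamma>. set_mset (names_tform x))"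
  by (induction \<Gamma>) auto

lemma snd_edges_tform: "snd ` edges_tform x w = Suc ` set_mset (names_tform x)"
proof (induction x arbitrary: w)
  case (TBr i \<Gamma>)
  have "snd ` edges_at (Suc i) \<Gamma> = Suc ` set_mset (names \<Gamma>)"
    unfolding edges_at_def set_names image_UN using TBr by simp
  then show ?case by simp
qed simp

text \<open>Each bracket is the target of an edge, so the edges determine which names occur; growth
  of the edges along a run is thereby growth of the set of names.\<close>

lemma snd_edges_at: "snd ` edges_at w \<Gamma> = Suc ` set_mset (names \<Gamma>)"
  unfolding edges_at_def set_names image_UN by (simp add: snd_edges_tform)

lemma fst_edges_tform: "fst ` edges_tform x w \<subseteq> insert w (Suc ` set_mset (names_tform x))"
proof (induction x arbitrary: w)
  case (TBr i \<Gamma>)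
  have "fst ` edges_at (Suc i) \<Gamma> \<subseteq> insert (Suc i) (Suc ` set_mset (names \<Gamma>))"
    unfolding edges_at_def set_names image_UN by (intro UN_least order_trans[OF TBr]) auto
  then show ?case by auto
qed simp

lemma fst_edges_at: "fst ` edges_at w \<Gamma> \<subseteq> insert w (Suc ` set_mset (names \<Gamma>))"
  unfolding edges_at_def set_names image_UN by (intro UN_least order_trans[OF fst_edges_tform]) auto

lemma fst_forms_tform: "fst ` forms_tform x w \<subseteq> insert w (Suc ` set_mset (names_tform x))"
proof (induction x arbitrary: w)
  case (TBr i \<Gamma>)
  have "fst ` forms_at (Suc i) \<Gamma> \<subseteq> insert (Suc i) (Suc ` set_mset (names \<Gamma>))"
    unfolding forms_at_def set_names image_UN by (intro UN_least order_trans[OF TBr]) auto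
  then show ?case by auto
qed simp

lemma fst_forms_at: "fst ` forms_at w \<Gamma> \<subseteq> insert w (Suc ` set_mset (names \<Gamma>))"
  unfolding forms_at_def set_names image_UN by (intro UN_least order_trans[OF fst_forms_tform]) auto

lemma finite_forms_tform: "finite (forms_tform x w)"
proof (induction x arbitrary: w)
  case (TBr i \<Gamma>)
  then show ?case unfolding forms_tform_TBr forms_at_def by (intro finite_UN_I) simp_all
qed simp

lemma finite_forms_at: "finite (forms_at w \<Gamma>)"
  unfolding forms_at_def by (intro finite_UN_I) (simp_all add: finite_forms_tform)

lemma finite_edges_at: "finite (edges_at w \<Gamma>)"
proof (rule finite_subset)
  show "edges_at w \<Gamma> \<subseteq> fst ` edges_at w \<Gamma> \<times> snd ` edges_at w \<Gamma>" by force
  show "finite (fst ` edges_at w \<Gamma> \<times> snd ` edges_at w \<Gamma>)"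
    unfolding snd_edges_at using finite_subset[OF fst_edges_at[of w \<Gamma>]] by simp
qed


section \<open>Contexts\<close>

text \<open>The context contributes a part \<open>G\<close> that is the same for every filling, so
  the effect of a rule on the set can be read off from the content of the hole alone.\<close>

lemma forms_at_fill: "\<exists>G. \<forall>\<Delta>. forms_at w (fill C \<Delta>) = G \<union> forms_at (pos_from w C) \<Delta>"
proof (induction C arbitrary: w)
  case (In \<Sigma> i C)
  obtain G where "\<forall>\<Delta>. forms_at (Suc i) (fill C \<Delta>) = G \<union> forms_at (pos_from (Suc i) C) \<Delta>"
    using In[of "Suc i"] ..
  then show ?case by (intro exI[of _ "forms_at w \<Sigma> \<union> G"]) auto
qed auto

lemma edges_at_fill: "\<exists>G. \<forall>\<Delta>. edges_at w (fill C \<Delta>) = G \<union> edges_at (pos_from w C) \<Delta>"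
proof (induction C arbitrary: w)
  case (In \<Sigma> i C)
  obtain G where "\<forall>\<Delta>. edges_at (Suc i) (fill C \<Delta>) = G \<union> edges_at (pos_from (Suc i) C) \<Delta>"
    using In[of "Suc i"] ..
  then show ?case by (intro exI[of _ "edges_at w \<Sigma> \<union> insert (w, Suc i) G"]) auto
qed auto

lemma names_fill: "\<exists>N. \<forall>\<Delta>. names (fill C \<Delta>) = N + names \<Delta>"
proof (induction C)
  case (In \<Sigma> i C)
  then obtain N where "\<forall>\<Delta>. names (fill C \<Delta>) = N + names \<Delta>"
    ..
  then show ?case by (intro exI[of _ "names \<Sigma> + add_mset i N"]) auto
qed auto

lemma fill_eq_empty: "fill C \<Delta> = {#} \<Longrightarrow> \<Delta> = {#}"
  by (cases C) auto

text \<open>The new content has to be non-empty because the hole may be the inside of a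
  bracket.\<close>

lemma nested_sequent_fill:
  assumes "nested_sequent (erase (fill C \<Delta>))" "nested_sequent (erase \<Delta>')" "\<Delta>' \<noteq> {#}"
  shows "nested_sequent (erase (fill C \<Delta>'))"
  using assms
proof (induction C)
  case (In \<Sigma> i C)
  have "fill C \<Delta>' \<noteq> {#}" using fill_eq_empty[of C \<Delta>'] assms(3) by blast
  with In show ?case by simp
qed simp

lemma nested_sequent_fillD:
  "nested_sequent (erase (fill C \<Delta>)) \<Longrightarrow> nested_sequent (erase \<Delta>)"
  by (induction C) auto

lemma pos_from_hole_path: "pos_from w C \<in> insert w (Suc ` set (hole_path C))"
  by (induction C arbitrary: w) auto

lemma hole_path_names: "set (hole_path C) \<subseteq> set_mset (names (fill C \<Delta>))"
  by (induction C) auto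

text \<open>Moves the hole into a bracket. The diamond rules are stated at the enclosing occurrence
  but add formulas inside the bracket; seen from the new context, they just add members at the
  hole.\<close>

lemma fill_append_In:
  "\<exists>C'. (\<forall>\<Theta>. fill C' \<Theta> = fill C (\<Sigma> + {#TBr i \<Theta>#})) \<and> pos_from w C' = Suc i"
proof (induction C arbitrary: w)
  case Hole
  show ?case by (intro exI[of _ "In \<Sigma> i Hole"]) auto
next
  case (In \<Sigma>' k C)
  then obtain C' where "\<forall>\<Theta>. fill C' \<Theta> = fill C (\<Sigma> + {#TBr i \<Theta>#})" "pos_from (Suc k) C' = Suc i"
    by blast
  then show ?case by (intro exI[of _ "In \<Sigma>' k C'"]) auto
qed

section \<open>Opening a sequent at a given position\<close>

lemma position_tform_fill:
  assumes "w \<in> Suc ` set_mset (names_tform x)"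
  shows "\<exists>i C \<Delta>. x = TBr i (fill C \<Delta>) \<and> pos_from (Suc i) C = w"
  using assms
proof (induction x)
  case (TBr i \<Gamma>)
  show ?case
  proof (cases "w = Suc i")
    case True
    then show ?thesis by (intro exI[of _ i] exI[of _ Hole] exI[of _ \<Gamma>]) auto
  next
    case False
    with TBr.prems have "w \<in> Suc ` set_mset (names \<Gamma>)" by auto
    then obtain y where y: "y \<in># \<Gamma>" "w \<in> Suc ` set_mset (names_tform y)"
      unfolding set_names by auto
    with TBr.IH obtain j C \<Delta> where "y = TBr j (fill C \<Delta>)" "pos_from (Suc j) C = w" by blast
    with y show ?thesis
      by (intro exI[of _ i] exI[of _ "In (\<Gamma> - {#y#}) j C"] exI[of _ \<Delta>]) auto
  qed
qed simp

lemma position_fill: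
  assumes "w \<in> insert v (Suc ` set_mset (names \<Gamma>))"
  shows "\<exists>C \<Delta>. \<Gamma> = fill C \<Delta> \<and> pos_from v C = w"
proof (cases "w = v")
  case True
  then show ?thesis by (intro exI[of _ Hole] exI[of _ \<Gamma>]) auto
next
  case False
  with assms obtain y where y: "y \<in># \<Gamma>" "w \<in> Suc ` set_mset (names_tform y)"
    unfolding set_names by auto
  with position_tform_fill obtain j C \<Delta> where "y = TBr j (fill C \<Delta>)" "pos_from (Suc j) C = w"
    by blast
  with y show ?thesis
    by (intro exI[of _ "In (\<Gamma> - {#y#}) j C"] exI[of _ \<Delta>]) auto
qed

lemma pos_from_names: "pos_from w C \<in> insert w (Suc ` set_mset (names (fill C \<Delta>)))"
  using pos_from_hole_path[of w C] hole_path_names[of C \<Delta>] by blast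

lemma pos_from_In_names: "pos_from v (In \<Sigma> i C) \<in> Suc ` insert i (set_mset (names (fill C \<Delta>)))"
  using pos_from_names[of "Suc i" C \<Delta>] by auto

lemma distinct_namesD:
  assumes "\<forall>i. count (M + N) i \<le> (1::nat)" "x \<in># M" shows "x \<notin># N"
proof
  assume "x \<in># N"
  with assms(2) have "count M x > 0" "count N x > 0" by auto
  with assms(1)[rule_format, of x] show False by simp
qed

text \<open>As names are unique and \<open>v\<close> is not the position of a bracket, no other
  occurrence shares the position of the hole. The hypothesis on \<open>v\<close> is what the
  induction passes on, from \<open>v\<close> to \<open>Suc i\<close>.\<close>

lemma form_at_hole:
  assumes "\<forall>i. count (names (fill C \<Delta>)) i \<le> 1" "v \<notin> Suc ` set_mset (names (fill C \<Delta>))"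
    "(pos_from v C, A) \<in> forms_at v (fill C \<Delta>)"
  shows "TFm A \<in># \<Delta>"
  using assms
proof (induction C arbitrary: v)
  case Hole
  then obtain x where x: "x \<in># \<Delta>" "(v, A) \<in> forms_tform x v" by (auto simp: forms_at_def)
  show ?case
  proof (cases x)
    case (TBr i \<Theta>)
    have "v \<in> insert (Suc i) (Suc ` set_mset (names \<Theta>))"
      using x fst_forms_at[of "Suc i" \<Theta>] TBr by force
    then have "v \<in> Suc ` set_mset (names_tform x)" by (auto simp: TBr)
    with x Hole show ?thesis by (auto simp: set_names)
  qed (use x in auto)
next
  case (In \<Sigma> i C)
  let ?N = "add_mset i (names (fill C \<Delta>))"
  have names: "names (fill (In \<Sigma> i C) \<Delta>) = ?N + names \<Sigma>" by simp
  have p: "pos_from v (In \<Sigma> i C) \<in> Suc ` set_mset ?N"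
    using pos_from_In_names[of v \<Sigma> i C \<Delta>] by simp
  then have "pos_from v (In \<Sigma> i C) \<notin> insert v (Suc ` set_mset (names \<Sigma>))"
    using In.prems(2) distinct_namesD[OF In.prems(1)[unfolded names]] unfolding names by auto
  then have "(pos_from v (In \<Sigma> i C), A) \<notin> forms_at v \<Sigma>"
    using fst_forms_at[of v \<Sigma>] by force
  with In.prems(3) have "(pos_from (Suc i) C, A) \<in> forms_at (Suc i) (fill C \<Delta>)" by simp
  moreover have "\<forall>i. count (names (fill C \<Delta>)) i \<le> 1"
  proof
    fix k show "count (names (fill C \<Delta>)) k \<le> 1"
      using In.prems(1)[rule_format, of k] by (simp split: if_splits)
  qed
  moreover have "Suc i \<notin> Suc ` set_mset (names (fill C \<Delta>))"
    using distinct_namesD[of "{#i#}" "names (fill C \<Delta>) + names \<Sigma>" i] In.prems(1) by auto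
  ultimately show ?case by (rule In.IH[rotated 2])
qed

text \<open>The argument of \<open>form_at_hole\<close>, now for edges: it recovers from an edge the
  bracket that a diamond rule has to display.\<close>

lemma bracket_at_hole:
  assumes "\<forall>i. count (names (fill C \<Delta>)) i \<le> 1" "v \<notin> Suc ` set_mset (names (fill C \<Delta>))"
    "(pos_from v C, u) \<in> edges_at v (fill C \<Delta>)"
  shows "\<exists>j \<Theta>. u = Suc j \<and> TBr j \<Theta> \<in># \<Delta>"
  using assms
proof (induction C arbitrary: v)
  case Hole
  then obtain x where x: "x \<in># \<Delta>" "(v, u) \<in> edges_tform x v" by (auto simp: edges_at_def)
  show ?case
  proof (cases x)
    case (TBr i \<Theta>)
    show ?thesis
    proof (cases "u = Suc i")
      case False
      have "v \<in> insert (Suc i) (Suc ` set_mset (names \<Theta>))"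
        using x fst_edges_at[of "Suc i" \<Theta>] TBr False by force
      then have "v \<in> Suc ` set_mset (names_tform x)" by (auto simp: TBr)
      with x Hole show ?thesis by (auto simp: set_names)
    qed (use x TBr in auto)
  qed (use x in auto)
next
  case (In \<Sigma> i C)
  let ?N = "add_mset i (names (fill C \<Delta>))"
  have names: "names (fill (In \<Sigma> i C) \<Delta>) = ?N + names \<Sigma>" by simp
  have p: "pos_from v (In \<Sigma> i C) \<in> Suc ` set_mset ?N"
    using pos_from_In_names[of v \<Sigma> i C \<Delta>] by simp
  then have *: "pos_from v (In \<Sigma> i C) \<notin> insert v (Suc ` set_mset (names \<Sigma>))"
    using In.prems(2) distinct_namesD[OF In.prems(1)[unfolded names]] unfolding names by auto
  then have "(pos_from v (In \<Sigma> i C), u) \<notin> edges_at v \<Sigma>"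
    using fst_edges_at[of v \<Sigma>] by force
  with In.prems(3) * have "(pos_from (Suc i) C, u) \<in> edges_at (Suc i) (fill C \<Delta>)" by auto
  moreover have "\<forall>i. count (names (fill C \<Delta>)) i \<le> 1"
  proof
    fix k show "count (names (fill C \<Delta>)) k \<le> 1"
      using In.prems(1)[rule_format, of k] by (simp split: if_splits)
  qed
  moreover have "Suc i \<notin> Suc ` set_mset (names (fill C \<Delta>))"
    using distinct_namesD[of "{#i#}" "names (fill C \<Delta>) + names \<Sigma>" i] In.prems(1) by auto
  ultimately show ?case by (rule In.IH[rotated 2])
qed

section \<open>Choosing names that increase towards the leaves\<close>

lemma ex_naming_sequent:
  assumes IH: "\<And>x n. x \<in># \<Gamma> \<Longrightarrow> \<exists>t. erase_tform t = x \<and> (\<forall>i. count (names_tform t) i \<le> 1) \<and>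
    (\<forall>i \<in># names_tform t. n \<le> i) \<and> (\<forall>w \<le> n. edges_tform t w \<subseteq> {(x, y). x < y})"
  shows "\<exists>\<Delta>. erase \<Delta> = \<Gamma> \<and> (\<forall>i. count (names \<Delta>) i \<le> 1) \<and>
    (\<forall>i \<in># names \<Delta>. n \<le> i) \<and> (\<forall>w \<le> n. edges_at w \<Delta> \<subseteq> {(x, y). x < y})"
  using assms
proof (induction \<Gamma> arbitrary: n)
  case empty
  show ?case by (intro exI[of _ "{#}"]) auto
next
  case (add x \<Gamma>)
  have "\<exists>\<Delta>. erase \<Delta> = \<Gamma> \<and> (\<forall>i. count (names \<Delta>) i \<le> 1) \<and>
    (\<forall>i \<in># names \<Delta>. n \<le> i) \<and> (\<forall>w \<le> n. edges_at w \<Delta> \<subseteq> {(x, y). x < y})"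
    by (rule add.IH) (use add.prems in auto)
  then obtain \<Delta> where \<Delta>: "erase \<Delta> = \<Gamma>" "\<forall>i. count (names \<Delta>) i \<le> 1"
    "\<forall>i \<in># names \<Delta>. n \<le> i" "\<forall>w \<le> n. edges_at w \<Delta> \<subseteq> {(x, y). x < y}" by blast
  \<comment> \<open>All names of \<open>\<Delta>\<close> lie below \<open>m\<close>, so naming the
    remaining member from \<open>max n m\<close> on keeps the names distinct.\<close>
  obtain m where m: "\<forall>i \<in># names \<Delta>. i < m"
    using finite_nat_set_iff_bounded[of "set_mset (names \<Delta>)"] by auto
  obtain t where t: "erase_tform t = x" "\<forall>i. count (names_tform t) i \<le> 1"
    "\<forall>i \<in># names_tform t. max n m \<le> i" "\<forall>w \<le> max n m. edges_tform t w \<subseteq> {(x, y). x < y}"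
    using add.prems[of x "max n m"] by auto
  have "count (names_tform t + names \<Delta>) i \<le> 1" for i
  proof (cases "i \<in># names \<Delta>")
    case True
    then have "i \<notin># names_tform t" using m t(3) by fastforce
    then show ?thesis using \<Delta>(2) by (simp add: not_in_iff)
  next
    case False
    then show ?thesis using t(2) by (simp add: not_in_iff)
  qed
  with \<Delta> t show ?case by (intro exI[of _ "add_mset t \<Delta>"]) auto
qed

text \<open>A name \<open>i \<ge> n\<close> gives the position \<open>Suc i\<close>, which exceeds
  every \<open>w \<le> n\<close>. A bracket takes the name \<open>n\<close> itself; its content
  hangs at position \<open>Suc n\<close> and is named from \<open>Suc n\<close> on.\<close>

lemma ex_naming_tform:
  "\<exists>t. erase_tform t = x \<and> (\<forall>i. count (names_tform t) i \<le> 1) \<and>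
    (\<forall>i \<in># names_tform t. n \<le> i) \<and> (\<forall>w \<le> n. edges_tform t w \<subseteq> {(x, y). x < y})"
proof (induction x arbitrary: n)
  case (Fm A)
  show ?case by (intro exI[of _ "TFm A"]) auto
next
  case (Br \<Gamma>)
  obtain \<Delta> where \<Delta>: "erase \<Delta> = \<Gamma>" "\<forall>i. count (names \<Delta>) i \<le> 1"
    "\<forall>i \<in># names \<Delta>. Suc n \<le> i" "\<forall>w \<le> Suc n. edges_at w \<Delta> \<subseteq> {(x, y). x < y}"
    using ex_naming_sequent[of \<Gamma> "Suc n"] Br by blast
  then have "n \<notin># names \<Delta>" by fastforce
  with \<Delta> show ?case
    by (intro exI[of _ "TBr n \<Delta>"]) (auto simp: not_in_iff)
qed

lemma ex_syntax_tree:
  assumes "nested_sequent \<Gamma>"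
  obtains \<Delta> where "erase \<Delta> = \<Gamma>" "syntax_tree \<Delta>" "edges_at 0 \<Delta> \<subseteq> {(x, y). x < y}"
  using ex_naming_sequent[OF ex_naming_tform, of \<Gamma> 0] assms by (auto simp: syntax_tree_def)


section \<open>Refutations\<close>

text \<open>A requirement \<open>(w, B, A, v)\<close> asks for the formula \<open>B\<close> at \<open>w\<close> to be decomposed;
  \<open>A\<close> selects a disjunct and \<open>v\<close> an immediate successor of \<open>w\<close>. The flag \<open>tr\<close> is true for
  transitive models. All formulas of a refutation are to be false at their position.\<close>

type_synonym 'a requirement = "nat \<times> 'a form \<times> 'a form \<times> nat"

primrec isub :: "'a form \<Rightarrow> 'a form set" where
  "isub (Atom p) = {}"
| "isub (NegAtom p) = {}"
| "isub (Conj X) = rcset X"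
| "isub (Disj X) = rcset X"
| "isub (Box A) = {A}"
| "isub (Dia A) = {A}"

text \<open>Confining \<open>A\<close> to \<open>B\<close> and its immediate subformulas keeps the
  requirements within a countable set; \<open>B\<close> itself is the dummy value when no disjunct
  is to be selected. A \<open>Dia\<close> requirement arises only once its edge exists.\<close>

fun active :: "(nat \<times> 'a form) set \<Rightarrow> (nat \<times> nat) set \<Rightarrow> 'a requirement \<Rightarrow> bool" where
  "active F E (w, B, A, v) \<longleftrightarrow> (w, B) \<in> F \<and> A \<in> insert B (isub B) \<and>
     ((\<exists>D. B = Dia D) \<longrightarrow> (w, v) \<in> E)"

text \<open>\<open>F\<close> and \<open>E\<close> occur only positively, so what is fulfilled stays
  fulfilled as the sets grow. An empty conjunction can never be fulfilled, in accordance with its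
  being an axiom.\<close>

fun fulfilled :: "bool \<Rightarrow> (nat \<times> 'a form) set \<Rightarrow> (nat \<times> nat) set \<Rightarrow> 'a requirement \<Rightarrow> bool" where
  "fulfilled tr F E (w, B, A, v) \<longleftrightarrow> (case B of
      Atom p \<Rightarrow> True
    | NegAtom p \<Rightarrow> True
    | Conj X \<Rightarrow> \<exists>D \<in> rcset X. (w, D) \<in> F
    | Disj X \<Rightarrow> A \<in> rcset X \<longrightarrow> (w, A) \<in> F
    | Box D \<Rightarrow> \<exists>u. (w, u) \<in> E \<and> (u, D) \<in> F
    | Dia D \<Rightarrow> (v, D) \<in> F \<and> (tr \<longrightarrow> (v, Dia D) \<in> F))"

definition refutation :: "bool \<Rightarrow> (nat \<times> 'a form) set \<Rightarrow> (nat \<times> nat) set \<Rightarrow> bool" where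
  "refutation tr F E \<longleftrightarrow> (\<forall>q. active F E q \<longrightarrow> fulfilled tr F E q) \<and>
     (\<forall>w p. \<not> ((w, Atom p) \<in> F \<and> (w, NegAtom p) \<in> F))"

lemma active_mono: "active F E q \<Longrightarrow> F \<subseteq> F' \<Longrightarrow> E \<subseteq> E' \<Longrightarrow> active F' E' q"
  by (cases q) auto

lemma fulfilled_mono: "fulfilled tr F E q \<Longrightarrow> F \<subseteq> F' \<Longrightarrow> E \<subseteq> E' \<Longrightarrow> fulfilled tr F' E' q"
  by (cases q) (auto split: form.splits)

lemma refutationD:
  assumes "refutation tr F E"
  shows "(w, Atom p) \<in> F \<Longrightarrow> (w, NegAtom p) \<notin> F"
    and "(w, Conj X) \<in> F \<Longrightarrow> \<exists>A \<in> rcset X. (w, A) \<in> F"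
    and "(w, Disj X) \<in> F \<Longrightarrow> A \<in> rcset X \<Longrightarrow> (w, A) \<in> F"
    and "(w, Box A) \<in> F \<Longrightarrow> \<exists>u. (w, u) \<in> E \<and> (u, A) \<in> F"
    and "(w, Dia A) \<in> F \<Longrightarrow> (w, u) \<in> E \<Longrightarrow> (u, A) \<in> F"
    and "(w, Dia A) \<in> F \<Longrightarrow> (w, u) \<in> E \<Longrightarrow> tr \<Longrightarrow> (u, Dia A) \<in> F"
proof -
  have ful: "active F E q \<Longrightarrow> fulfilled tr F E q" for q
    using assms unfolding refutation_def by blast
  show "(w, Atom p) \<in> F \<Longrightarrow> (w, NegAtom p) \<notin> F"
    using assms by (auto simp: refutation_def)
  show "(w, Conj X) \<in> F \<Longrightarrow> \<exists>A \<in> rcset X. (w, A) \<in> F"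
    using ful[of "(w, Conj X, Conj X, 0)"] by simp
  show "(w, Disj X) \<in> F \<Longrightarrow> A \<in> rcset X \<Longrightarrow> (w, A) \<in> F"
    using ful[of "(w, Disj X, A, 0)"] by simp
  show "(w, Box A) \<in> F \<Longrightarrow> \<exists>u. (w, u) \<in> E \<and> (u, A) \<in> F"
    using ful[of "(w, Box A, A, 0)"] by simp
  show "(w, Dia A) \<in> F \<Longrightarrow> (w, u) \<in> E \<Longrightarrow> (u, A) \<in> F"
    using ful[of "(w, Dia A, A, u)"] by simp
  show "(w, Dia A) \<in> F \<Longrightarrow> (w, u) \<in> E \<Longrightarrow> tr \<Longrightarrow> (u, Dia A) \<in> F"
    using ful[of "(w, Dia A, A, u)"] by simp
qed

text \<open>The flag makes \<open>Dia D\<close> persist along edges, hence along paths, so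
  \<open>D\<close> is recorded at every position reachable from it. \<open>Box\<close> only gains
  successors to choose from.\<close>

lemma refutation_trancl:
  assumes "refutation True F E"
  shows "refutation False F (E\<^sup>+)"
proof -
  have dia: "(u, D) \<in> F \<and> (u, Dia D) \<in> F" if "(w, u) \<in> E\<^sup>+" "(w, Dia D) \<in> F" for w u D
    using that by (induction rule: trancl_induct) (auto dest: refutationD(5,6)[OF assms])
  have "fulfilled False F (E\<^sup>+) (w, B, A, v)" if "active F (E\<^sup>+) (w, B, A, v)" for w B A v
    using that dia refutationD(2-4)[OF assms] by (cases B) (simp; blast)+
  then show ?thesis
    using refutationD(1)[OF assms] by (auto simp: refutation_def simp del: active.simps fulfilled.simps)
qed

section \<open>Countermodels from refutations\<close>

definition refutation_model ::
    "(nat \<Rightarrow> 'w) \<Rightarrow> (nat \<times> 'a form) set \<Rightarrow> (nat \<times> nat) set \<Rightarrow> ('w, 'a) kripke" where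
  "refutation_model \<iota> F E = \<lparr>worlds = UNIV, acc = map_prod \<iota> \<iota> ` E, dom_atoms = UNIV,
     val = {(\<iota> w, p) |w p. (w, NegAtom p) \<in> F}\<rparr>"

lemma refutation_model_simps [simp]:
  "worlds (refutation_model \<iota> F E) = UNIV"
  "acc (refutation_model \<iota> F E) = map_prod \<iota> \<iota> ` E"
  "dom_atoms (refutation_model \<iota> F E) = UNIV"
  "val (refutation_model \<iota> F E) = {(\<iota> w, p) |w p. (w, NegAtom p) \<in> F}"
  by (auto simp: refutation_model_def)

lemma kripke_model_refutation_model: "kripke_model (refutation_model \<iota> F E)"
  by (simp add: kripke_model_def)

lemma supports_refutation_model: "supports (refutation_model \<iota> F E) \<Gamma>"
  by (simp add: supports_def)

lemma trans_map_prod: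
  assumes "inj \<iota>" "trans R"
  shows "trans (map_prod \<iota> \<iota> ` R)"
proof (rule transI)
  fix x y z assume "(x, y) \<in> map_prod \<iota> \<iota> ` R" "(y, z) \<in> map_prod \<iota> \<iota> ` R"
  then obtain a b b' c where *: "(a, b) \<in> R" "(b', c) \<in> R" "x = \<iota> a" "y = \<iota> b" "y = \<iota> b'" "z = \<iota> c"
    by auto
  then have "b = b'" using assms(1) by (auto dest: injD)
  with * have "(a, c) \<in> R" using assms(2) by (auto dest: transD)
  with * show "(x, z) \<in> map_prod \<iota> \<iota> ` R" by force
qed

text \<open>An atom is true exactly where its negation is recorded, so without clashes both kinds of
  recorded literals are false. Injectivity of \<open>\<iota>\<close> prevents a world from standing
  for two positions, which matters for atoms and for the successors inspected by
  \<open>Dia\<close>.\<close>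

lemma sat_refutation_model:
  assumes "inj \<iota>" "refutation tr F E" "(w, A) \<in> F"
  shows "\<not> sat (refutation_model \<iota> F E) A (\<iota> w)"
  using assms(3)
proof (induction A arbitrary: w)
  case (Atom p)
  then have "(w, NegAtom p) \<notin> F" using refutationD(1)[OF assms(2)] by blast
  then show ?case using injD[OF assms(1)] by auto
next
  case (NegAtom p)
  then show ?case by auto
next
  case (Conj X)
  then obtain A where "A \<in> rcset X" "(w, A) \<in> F" using refutationD(2)[OF assms(2)] by blast
  with Conj.IH show ?case unfolding sat_Conj by blast
next
  case (Disj X)
  then have "(w, A) \<in> F" if "A \<in> rcset X" for A using that refutationD(3)[OF assms(2)] by blast
  with Disj.IH show ?case unfolding sat_Disj by blast
next
  case (Box A)
  then obtain u where "(w, u) \<in> E" "(u, A) \<in> F" using refutationD(4)[OF assms(2)] by blast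
  with Box.IH show ?case by force
next
  case (Dia A)
  then have "(u, A) \<in> F" if "(w, u) \<in> E" for u using that refutationD(5)[OF assms(2)] by blast
  with Dia.IH show ?case using injD[OF assms(1)] by auto
qed

lemma nsat_refutation_model:
  assumes "inj \<iota>" "refutation tr F E"
  shows "forms_tform x w \<subseteq> F \<Longrightarrow> edges_tform x w \<subseteq> E \<Longrightarrow>
    \<not> nsat (refutation_model \<iota> F E) (erase_tform x) (\<iota> w)"
proof (induction x arbitrary: w)
  case (TFm A)
  then show ?case using sat_refutation_model[OF assms] by simp
next
  case (TBr i \<Gamma>)
  have "\<not> nsat (refutation_model \<iota> F E) (erase_tform x) (\<iota> (Suc i))" if "x \<in># \<Gamma>" for x
  proof (rule TBr.IH[OF that])
    show "forms_tform x (Suc i) \<subseteq> F"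
      using TBr.prems(1) that by (auto simp: forms_at_def)
    show "edges_tform x (Suc i) \<subseteq> E"
      using TBr.prems(2) that by (auto simp: edges_at_def)
  qed
  then have "\<not> sat_sequent (refutation_model \<iota> F E) (erase \<Gamma>) (\<iota> (Suc i))"
    by (auto simp: sat_sequent_def erase_def)
  moreover have "(\<iota> w, \<iota> (Suc i)) \<in> acc (refutation_model \<iota> F E)"
    using TBr.prems(2) by force
  ultimately show ?case unfolding erase_tform_TBr nsat_Br by blast
qed

lemma refutation_not_valid:
  assumes "inj \<iota>" "refutation tr F E" "forms_at 0 \<Gamma> \<subseteq> F" "edges_at 0 \<Gamma> \<subseteq> E"
  shows "\<not> valid_in (refutation_model \<iota> F E) (erase \<Gamma>)"
proof -
  have "\<not> nsat (refutation_model \<iota> F E) (erase_tform x) (\<iota> 0)" if "x \<in># \<Gamma>" for x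
    using nsat_refutation_model[OF assms(1,2), of x 0] assms(3,4) that
    by (auto simp: forms_at_def edges_at_def)
  then show ?thesis
    by (auto simp: valid_in_def sat_sequent_def erase_def)
qed


section \<open>Reduction steps\<close>

definition closed :: "'a form set \<Rightarrow> bool" where
  "closed U \<longleftrightarrow> (\<forall>B \<in> U. isub B \<subseteq> U)"

text \<open>The order on edges serves twice: it makes the finite edge set of a leaf acyclic, and it
  makes every infinite path of the limit strictly increasing.\<close>

definition search_state :: "'a form set \<Rightarrow> 'a tsequent \<Rightarrow> bool" where
  "search_state U \<Gamma> \<longleftrightarrow> syntax_tree \<Gamma> \<and> snd ` forms_at 0 \<Gamma> \<subseteq> U \<and>
     edges_at 0 \<Gamma> \<subseteq> {(x, y). x < y}"

text \<open>The one new edge runs from the designated occurrence to the created bracket. An edge of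
  the limit can thus be traced back to the instance that produced it.\<close>

definition adds_bracket :: "'a tsequent \<Rightarrow> 'a tsequent \<Rightarrow> bool" where
  "adds_bracket \<Gamma> \<Gamma>' \<longleftrightarrow> (\<exists>C i. box_instance C i \<Gamma>' \<Gamma> \<and>
     edges_at 0 \<Gamma>' = insert (pos_from 0 C, Suc i) (edges_at 0 \<Gamma>))"

definition step :: "'a form set \<Rightarrow> 'a tsequent \<Rightarrow> 'a tsequent \<Rightarrow> bool" where
  "step U \<Gamma> \<Gamma>' \<longleftrightarrow> search_state U \<Gamma>' \<and> forms_at 0 \<Gamma> \<subseteq> forms_at 0 \<Gamma>' \<and>
     edges_at 0 \<Gamma> \<subseteq> edges_at 0 \<Gamma>' \<and>
     (edges_at 0 \<Gamma>' = edges_at 0 \<Gamma> \<or> adds_bracket \<Gamma> \<Gamma>')"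

definition rules :: "bool \<Rightarrow> rule set" where
  "rules tr = {NegR, AndR, OrR, if tr then DiaR else WDiaR, BoxR}"

lemma search_state_fill_formula:
  assumes "search_state U (fill C \<Delta>)" "A \<in> U"
  shows "search_state U (fill C (add_mset (TFm A) \<Delta>))"
    and "forms_at 0 (fill C (add_mset (TFm A) \<Delta>)) =
      insert (pos_from 0 C, A) (forms_at 0 (fill C \<Delta>))"
    and "edges_at 0 (fill C (add_mset (TFm A) \<Delta>)) = edges_at 0 (fill C \<Delta>)"
proof -
  obtain G where G: "\<And>\<Delta>. forms_at 0 (fill C \<Delta>) = G \<union> forms_at (pos_from 0 C) \<Delta>"
    using forms_at_fill[of 0 C] by blast
  obtain H where H: "\<And>\<Delta>. edges_at 0 (fill C \<Delta>) = H \<union> edges_at (pos_from 0 C) \<Delta>"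
    using edges_at_fill[of 0 C] by blast
  obtain N where N: "\<And>\<Delta>. names (fill C \<Delta>) = N + names \<Delta>"
    using names_fill[of C] by blast
  show forms: "forms_at 0 (fill C (add_mset (TFm A) \<Delta>)) =
      insert (pos_from 0 C, A) (forms_at 0 (fill C \<Delta>))"
    unfolding G by simp
  show edges: "edges_at 0 (fill C (add_mset (TFm A) \<Delta>)) = edges_at 0 (fill C \<Delta>)"
    unfolding H by simp
  have "names (fill C (add_mset (TFm A) \<Delta>)) = names (fill C \<Delta>)"
    unfolding N by simp
  moreover have nested: "nested_sequent (erase (fill C \<Delta>))"
    using assms(1) by (simp add: search_state_def syntax_tree_def)
  have "nested_sequent (erase (fill C (add_mset (TFm A) \<Delta>)))"
    by (rule nested_sequent_fill[OF nested]) (use nested_sequent_fillD[OF nested] in auto)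
  ultimately show "search_state U (fill C (add_mset (TFm A) \<Delta>))"
    using assms forms edges by (simp add: search_state_def syntax_tree_def)
qed

lemma step_formula:
  assumes "search_state U (fill C \<Delta>)" "A \<in> U"
  shows "step U (fill C \<Delta>) (fill C (add_mset (TFm A) \<Delta>))"
  using search_state_fill_formula[OF assms] by (auto simp: step_def)

text \<open>The bridge from sets back to rules: whatever the sets record at \<open>w\<close> is
  found as an actual member of the content of the hole.\<close>

lemma hole_cases:
  assumes "search_state U \<Gamma>" "(w, B) \<in> forms_at 0 \<Gamma>"
  obtains C \<Delta> where "\<Gamma> = fill C (add_mset (TFm B) \<Delta>)" "pos_from 0 C = w"
    "\<And>A. (w, A) \<in> forms_at 0 \<Gamma> \<Longrightarrow> TFm A \<in># add_mset (TFm B) \<Delta>"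
    "\<And>u. (w, u) \<in> edges_at 0 \<Gamma> \<Longrightarrow> \<exists>j \<Theta>. u = Suc j \<and> TBr j \<Theta> \<in># \<Delta>"
proof -
  have "w \<in> insert 0 (Suc ` set_mset (names \<Gamma>))"
    using fst_forms_at[of 0 \<Gamma>] assms(2) by force
  then obtain C \<Delta> where C: "\<Gamma> = fill C \<Delta>" "pos_from 0 C = w"
    using position_fill by blast
  have distinct: "\<forall>i. count (names (fill C \<Delta>)) i \<le> 1"
    using assms(1) by (simp add: search_state_def syntax_tree_def C)
  have form: "TFm A \<in># \<Delta>" if "(w, A) \<in> forms_at 0 \<Gamma>" for A
    using form_at_hole[OF distinct, of 0 A] that C by auto
  then obtain \<Delta>' where \<Delta>': "\<Delta> = add_mset (TFm B) \<Delta>'"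
    using assms(2) by (blast dest: multi_member_split)
  have bracket: "\<exists>j \<Theta>. u = Suc j \<and> TBr j \<Theta> \<in># \<Delta>'" if "(w, u) \<in> edges_at 0 \<Gamma>" for u
    using bracket_at_hole[OF distinct, of 0 u] that C \<Delta>' by auto
  show thesis
    using that[of C \<Delta>'] C form bracket \<Delta>' by blast
qed

lemma is_axiom_if_clash:
  assumes "search_state U \<Gamma>" "(w, Atom p) \<in> forms_at 0 \<Gamma>" "(w, NegAtom p) \<in> forms_at 0 \<Gamma>"
  shows "is_axiom \<Gamma>"
proof -
  obtain C \<Delta> where "\<Gamma> = fill C (add_mset (TFm (Atom p)) \<Delta>)" "TFm (NegAtom p) \<in># add_mset (TFm (Atom p)) \<Delta>"
    using hole_cases[OF assms(1,2)] assms(3) by metis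
  then obtain \<Delta>' where "\<Gamma> = fill C (\<Delta>' + {#TFm (Atom p), TFm (NegAtom p)#})"
    using multi_member_split[of "TFm (NegAtom p)" \<Delta>] by (auto simp: add_mset_commute)
  then show ?thesis
    using rule_instance.intros(1) by (auto simp: is_axiom_def)
qed

text \<open>Every premise has to fulfil \<open>q\<close>, so fairness holds along all branches
  alike. Countability lets the premises be the children of a node, which form a
  \<open>cset\<close>.\<close>

definition reduces :: "bool \<Rightarrow> 'a form set \<Rightarrow> 'a requirement \<Rightarrow> 'a tsequent \<Rightarrow> 'a tsequent set \<Rightarrow> bool" where
  "reduces tr U q \<Gamma> P \<longleftrightarrow> (\<exists>r \<in> rules tr. rule_instance r P \<Gamma>) \<and> countable P \<and>
     (\<forall>\<Gamma>' \<in> P. step U \<Gamma> \<Gamma>' \<and> fulfilled tr (forms_at 0 \<Gamma>') (edges_at 0 \<Gamma>') q)"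

lemma reduces_Conj:
  assumes U: "closed U" and \<Gamma>: "search_state U \<Gamma>" and B: "(w, Conj X) \<in> forms_at 0 \<Gamma>"
  shows "\<exists>P. reduces tr U (w, Conj X, A, v) \<Gamma> P"
proof -
  obtain C \<Delta> where C: "\<Gamma> = fill C (add_mset (TFm (Conj X)) \<Delta>)" "pos_from 0 C = w"
    using hole_cases[OF \<Gamma> B] by metis
  let ?p = "\<lambda>D. fill C (\<Delta> + {#TFm (Conj X), TFm D#})"
  have "rule_instance AndR {?p D |D. D \<in> rcset X} \<Gamma>"
    using rule_instance.intros(2)[of C \<Delta> X] C by simp
  moreover have "{?p D |D. D \<in> rcset X} = ?p ` rcset X" by blast
  moreover have "step U \<Gamma> (?p D) \<and> fulfilled tr (forms_at 0 (?p D)) (edges_at 0 (?p D)) (w, Conj X, A, v)"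
    if "D \<in> rcset X" for D
  proof -
    have "Conj X \<in> U" using \<Gamma> B by (force simp: search_state_def)
    then have "D \<in> U" using U that by (force simp: closed_def)
    then show ?thesis
      using step_formula[of U C "add_mset (TFm (Conj X)) \<Delta>" D] \<Gamma> C that
        search_state_fill_formula(2)[of U C "add_mset (TFm (Conj X)) \<Delta>" D]
      by (auto simp: add_mset_commute)
  qed
  ultimately show ?thesis
    unfolding reduces_def rules_def by (intro exI[of _ "?p ` rcset X"]) auto
qed

lemma reduces_Disj:
  assumes U: "closed U" and \<Gamma>: "search_state U \<Gamma>" and B: "(w, Disj X) \<in> forms_at 0 \<Gamma>"
    and A: "A \<in> rcset X"
  shows "\<exists>P. reduces tr U (w, Disj X, A, v) \<Gamma> P"
proof -
  obtain C \<Delta> where C: "\<Gamma> = fill C (add_mset (TFm (Disj X)) \<Delta>)" "pos_from 0 C = w"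
    using hole_cases[OF \<Gamma> B] by metis
  let ?p = "fill C (\<Delta> + {#TFm (Disj X), TFm A#})"
  have "rule_instance OrR {?p} \<Gamma>"
    using rule_instance.intros(3)[OF A, of C \<Delta>] C by simp
  moreover have "step U \<Gamma> ?p \<and> fulfilled tr (forms_at 0 ?p) (edges_at 0 ?p) (w, Disj X, A, v)"
  proof -
    have "Disj X \<in> U" using \<Gamma> B by (force simp: search_state_def)
    then have "A \<in> U" using U A by (force simp: closed_def)
    then show ?thesis
      using step_formula[of U C "add_mset (TFm (Disj X)) \<Delta>" A] \<Gamma> C 
        search_state_fill_formula(2)[of U C "add_mset (TFm (Disj X)) \<Delta>" A]
      by (auto simp: add_mset_commute)
  qed
  ultimately show ?thesis
    unfolding reduces_def rules_def by (intro exI[of _ "{?p}"]) auto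
qed

text \<open>The new bracket gets a name larger than all others, so that positions increase along edges.\<close>

lemma reduces_Box:
  assumes U: "closed U" and \<Gamma>: "search_state U \<Gamma>" and B: "(w, Box D) \<in> forms_at 0 \<Gamma>"
  shows "\<exists>P. reduces tr U (w, Box D, A, v) \<Gamma> P"
proof -
  obtain C \<Delta> where C: "\<Gamma> = fill C (add_mset (TFm (Box D)) \<Delta>)" "pos_from 0 C = w"
    using hole_cases[OF \<Gamma> B] by metis
  obtain i where i: "\<forall>j \<in># names \<Gamma>. j < i"
    using finite_nat_set_iff_bounded[of "set_mset (names \<Gamma>)"] by auto
  have "w \<in> insert 0 (Suc ` set_mset (names \<Gamma>))"
    using fst_forms_at[of 0 \<Gamma>] B by force
  with i have w: "w < Suc i" by auto
  let ?p = "fill C (\<Delta> + {#TBr i {#TFm D#}, TFm (Box D)#})"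
  have box: "box_instance C i ?p \<Gamma>"
    unfolding box_instance_def using C i by auto
  have D: "D \<in> U"
    using U \<Gamma> B by (force simp: search_state_def closed_def)
  obtain G where G: "\<And>\<Delta>. forms_at 0 (fill C \<Delta>) = G \<union> forms_at w \<Delta>"
    using forms_at_fill[of 0 C] C by blast
  obtain H where H: "\<And>\<Delta>. edges_at 0 (fill C \<Delta>) = H \<union> edges_at w \<Delta>"
    using edges_at_fill[of 0 C] C by blast
  obtain N where N: "\<And>\<Delta>. names (fill C \<Delta>) = N + names \<Delta>"
    using names_fill[of C] by blast
  have forms: "forms_at 0 ?p = insert (Suc i, D) (forms_at 0 \<Gamma>)"
    unfolding C G by auto
  have edges: "edges_at 0 ?p = insert (w, Suc i) (edges_at 0 \<Gamma>)"
    unfolding C H by auto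
  have names: "names ?p = add_mset i (names \<Gamma>)"
    unfolding C N by simp
  have nested: "nested_sequent (erase (fill C (add_mset (TFm (Box D)) \<Delta>)))"
    using \<Gamma> by (simp add: search_state_def syntax_tree_def C)
  have "nested_sequent (erase ?p)"
    by (rule nested_sequent_fill[OF nested]) (use nested_sequent_fillD[OF nested] in auto)
  moreover have "i \<notin># names \<Gamma>" using i by blast
  ultimately have "search_state U ?p"
    using \<Gamma> D w unfolding search_state_def syntax_tree_def forms edges names
    by (auto simp: not_in_iff)
  then have "step U \<Gamma> ?p"
    unfolding step_def adds_bracket_def using box forms edges C by blast
  moreover have "fulfilled tr (forms_at 0 ?p) (edges_at 0 ?p) (w, Box D, A, v)"
    unfolding forms edges by auto
  ultimately show ?thesis
    unfolding reduces_def rules_def using rule_instance.intros(6)[OF box]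
    by (intro exI[of _ "{?p}"]) auto
qed

lemma reduces_Dia:
  assumes U: "closed U" and \<Gamma>: "search_state U \<Gamma>" and B: "(w, Dia D) \<in> forms_at 0 \<Gamma>"
    and v: "(w, v) \<in> edges_at 0 \<Gamma>"
  shows "\<exists>P. reduces tr U (w, Dia D, A, v) \<Gamma> P"
proof -
  obtain C \<Delta> i \<Theta> where C: "\<Gamma> = fill C (add_mset (TFm (Dia D)) \<Delta>)" "pos_from 0 C = w"
    "v = Suc i" "TBr i \<Theta> \<in># \<Delta>"
    using hole_cases[OF \<Gamma> B] v by metis
  then obtain \<Delta>' where \<Delta>': "\<Delta> = add_mset (TBr i \<Theta>) \<Delta>'"
    by (blast dest: multi_member_split)
  \<comment> \<open>The same sequent with the hole inside the bracket \<open>i\<close>. Adding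
    \<open>D\<close> there gives the premise of the weak rule, adding \<open>Dia D\<close> as well
    gives that of the other.\<close>
  obtain C' where C': "\<And>\<Theta>. fill C' \<Theta> = fill C (\<Delta>' + {#TFm (Dia D)#} + {#TBr i \<Theta>#})"
    "pos_from 0 C' = v"
    using fill_append_In[of C "\<Delta>' + {#TFm (Dia D)#}" i 0] C by auto
  have \<Gamma>C': "\<Gamma> = fill C' \<Theta>"
    unfolding C' C \<Delta>' by (simp add: add_mset_commute)
  have DU: "Dia D \<in> U" "D \<in> U"
    using U \<Gamma> B by (force simp: search_state_def closed_def)+
  let ?p1 = "fill C' (add_mset (TFm D) \<Theta>)"
  let ?p2 = "fill C' (add_mset (TFm (Dia D)) (add_mset (TFm D) \<Theta>))"
  have state1: "search_state U ?p1" and forms1: "forms_at 0 ?p1 = insert (v, D) (forms_at 0 \<Gamma>)"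
    and edges1: "edges_at 0 ?p1 = edges_at 0 \<Gamma>"
    using search_state_fill_formula[of U C' \<Theta> D] \<Gamma> DU C' \<Gamma>C' by auto
  have state2: "search_state U ?p2" and forms2: "forms_at 0 ?p2 = insert (v, Dia D) (forms_at 0 ?p1)"
    and edges2: "edges_at 0 ?p2 = edges_at 0 \<Gamma>"
    using search_state_fill_formula[of U C' "add_mset (TFm D) \<Theta>" "Dia D"] state1 edges1 DU C' by auto
  show ?thesis
  proof (cases tr)
    case True
    have "rule_instance DiaR {?p2} \<Gamma>"
      using rule_instance.intros(4)[of C \<Delta>' i \<Theta> D] unfolding \<Gamma>C' C'
      by (simp add: add_mset_commute)
    then show ?thesis
      unfolding reduces_def rules_def step_def using state2 forms1 forms2 edges2 True
      by (intro exI[of _ "{?p2}"]) auto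
  next
    case False
    have "rule_instance WDiaR {?p1} \<Gamma>"
      using rule_instance.intros(5)[of C \<Delta>' i \<Theta> D] unfolding \<Gamma>C' C'
      by (simp add: add_mset_commute)
    then show ?thesis
      unfolding reduces_def rules_def step_def using state1 forms1 edges1 False
      by (intro exI[of _ "{?p1}"]) auto
  qed
qed

lemma ex_reduces:
  assumes U: "closed U" and \<Gamma>: "search_state U \<Gamma>"
    and q: "active (forms_at 0 \<Gamma>) (edges_at 0 \<Gamma>) q"
      "\<not> fulfilled tr (forms_at 0 \<Gamma>) (edges_at 0 \<Gamma>) q"
  shows "\<exists>P. reduces tr U q \<Gamma> P"
proof -
  obtain w B A v where [simp]: "q = (w, B, A, v)" by (cases q)
  show ?thesis
  proof (cases B)
    case (Conj X)
    then show ?thesis using q reduces_Conj[OF U \<Gamma>] by auto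
  next
    case (Disj X)
    then show ?thesis using q reduces_Disj[OF U \<Gamma>] by auto
  next
    case (Box D)
    then show ?thesis using q reduces_Box[OF U \<Gamma>] by auto
  next
    case (Dia D)
    then show ?thesis using q reduces_Dia[OF U \<Gamma>] by auto
  qed (use q in auto)
qed

text \<open>Only the axiom and the rule for conjunctions can lack premises; the others have exactly
  one.\<close>

lemma is_axiom_if_no_premises: "rule_instance r {} \<Gamma> \<Longrightarrow> is_axiom \<Gamma>"
  unfolding is_axiom_def by (cases r) (auto elim: rule_instance.cases)


section \<open>Infinite reduction sequences\<close>

text \<open>Always reducing an unfulfilled requirement with the least code is fair: as long as a
  requirement stays unfulfilled, each step fulfils another one with a smaller code for good.\<close>

lemma refutation_fair_run:
  fixes s :: "nat \<Rightarrow> 'a tsequent" and code :: "'a requirement \<Rightarrow> nat"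
    and tr :: bool
  defines "F n \<equiv> forms_at 0 (s n)" and "E n \<equiv> edges_at 0 (s n)"
  defines "unfulfilled n q \<equiv> active (F n) (E n) q \<and> \<not> fulfilled tr (F n) (E n) q"
  assumes code: "\<And>m n q q'. unfulfilled m q \<Longrightarrow> unfulfilled n q' \<Longrightarrow> code q = code q' \<Longrightarrow> q = q'"
    and state: "\<And>n. search_state U (s n)"
    and step: "\<And>n. step U (s n) (s (Suc n))"
    and no_axiom: "\<And>n. \<not> is_axiom (s n)"
    and least: "\<And>n. \<exists>q. unfulfilled n q \<and> (\<forall>q'. unfulfilled n q' \<longrightarrow> code q \<le> code q') \<and>
      fulfilled tr (F (Suc n)) (E (Suc n)) q"
  shows "refutation tr (\<Union>n. F n) (\<Union>n. E n)"
proof -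
  have F_Suc: "F n \<subseteq> F (Suc n)" and E_Suc: "E n \<subseteq> E (Suc n)" for n
    using step[of n] by (simp_all add: F_def E_def step_def)
  have F_mono: "F m \<subseteq> F n" and E_mono: "E m \<subseteq> E n" if "m \<le> n" for m n
    using lift_Suc_mono_le[of F, OF F_Suc that] lift_Suc_mono_le[of E, OF E_Suc that] .
  have "fulfilled tr (\<Union>n. F n) (\<Union>n. E n) q" if q: "active (\<Union>n. F n) (\<Union>n. E n) q" for q
  proof (rule ccontr)
    assume not: "\<not> fulfilled tr (\<Union>n. F n) (\<Union>n. E n) q"
    obtain w B A v where [simp]: "q = (w, B, A, v)" by (cases q)
    \<comment> \<open>A \<open>Dia\<close> requirement needs a formula and an edge, which may appear
      at different stages; the later one serves.\<close>
    obtain n where "active (F n) (E n) q"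
    proof (cases "\<exists>D. B = Dia D")
      case True
      with q obtain k l where "(w, B) \<in> F k" "(w, v) \<in> E l" by auto
      then have "(w, B) \<in> F (max k l)" "(w, v) \<in> E (max k l)"
        using F_mono[of k "max k l"] E_mono[of l "max k l"] by auto
      with q that[of "max k l"] show thesis by auto
    next
      case False
      with q obtain k where "(w, B) \<in> F k" by auto
      with q that[of k] False show thesis by auto
    qed
    then have active: "active (F m) (E m) q" if "m \<ge> n" for m
      using active_mono[OF _ F_mono[OF that] E_mono[OF that]] by blast
    have "\<not> fulfilled tr (F m) (E m) q" for m
      using not fulfilled_mono[of tr "F m" "E m" q "\<Union>n. F n" "\<Union>n. E n"] by blast
    with active have pending: "unfulfilled m q" if "m \<ge> n" for m
      using that unfolding unfulfilled_def by blast
    obtain c where c: "\<And>n. unfulfilled n (c n)" "\<And>n q'. unfulfilled n q' \<Longrightarrow> code (c n) \<le> code q'"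
      "\<And>n. fulfilled tr (F (Suc n)) (E (Suc n)) (c n)"
      using least by metis
    have distinct: "code (c k) \<noteq> code (c l)" if "k < l" for k l
    proof
      assume "code (c k) = code (c l)"
      then have "c k = c l" using code c(1) by blast
      then have "fulfilled tr (F l) (E l) (c l)"
        using c(3)[of k] F_mono[of "Suc k" l] E_mono[of "Suc k" l] that
        by (metis Suc_leI fulfilled_mono)
      with c(1)[of l] show False by (simp add: unfulfilled_def)
    qed
    \<comment> \<open>From stage \<open>n\<close> on, infinitely many distinct codes would lie below
      that of \<open>q\<close>.\<close>
    have "inj_on (\<lambda>m. code (c m)) {n..}"
      using distinct by (metis inj_onI nat_neq_iff)
    moreover have "(\<lambda>m. code (c m)) ` {n..} \<subseteq> {..code q}"
      using c(2) pending by auto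
    ultimately show False
      using finite_subset[OF _ finite_atMost] finite_imageD infinite_Ici by blast
  qed
  moreover have False if clash: "(w, Atom p) \<in> (\<Union>n. F n)" "(w, NegAtom p) \<in> (\<Union>n. F n)" for w p
  proof -
    from clash obtain k l where "(w, Atom p) \<in> F k" "(w, NegAtom p) \<in> F l" by blast
    then have "(w, Atom p) \<in> F (max k l)" "(w, NegAtom p) \<in> F (max k l)"
      using F_mono[of k "max k l"] F_mono[of l "max k l"] by auto
    then show False
      using is_axiom_if_clash[OF state[of "max k l"]] no_axiom by (auto simp: F_def)
  qed
  ultimately show ?thesis unfolding refutation_def by blast
qed

text \<open>Consecutive edges of an infinite path share a position: the bracket created for one edge
  is the designated occurrence of the instance creating the next, which is nestedness.\<close>

lemma progress_if_not_wf:
  fixes s :: "nat \<Rightarrow> 'a tsequent"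
  assumes state: "\<And>n. search_state U (s n)"
    and step: "\<And>n. step U (s n) (s (Suc n))"
    and "\<not> wf ((\<Union>n. edges_at 0 (s n))\<inverse>)"
  shows "\<exists>g C i. strict_mono (g :: nat \<Rightarrow> nat) \<and>
    (\<forall>k. box_instance (C k) (i k) (s (Suc (g k))) (s (g k)) \<and> i k \<in> set (hole_path (C (Suc k))))"
proof -
  have names_mono: "set_mset (names (s m)) \<subseteq> set_mset (names (s n))" if "m \<le> n" for m n
  proof -
    have "edges_at 0 (s k) \<subseteq> edges_at 0 (s (Suc k))" for k
      using step[of k] by (simp add: step_def)
    then have "edges_at 0 (s m) \<subseteq> edges_at 0 (s n)"
      by (rule lift_Suc_mono_le[of "\<lambda>n. edges_at 0 (s n)"]) (rule that)
    then have "Suc ` set_mset (names (s m)) \<subseteq> Suc ` set_mset (names (s n))"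
      unfolding snd_edges_at[of 0, symmetric] by blast
    then show ?thesis by auto
  qed
  obtain f where f: "\<And>k. (f k, f (Suc k)) \<in> (\<Union>n. edges_at 0 (s n))"
    using assms(3) unfolding wf_iff_no_infinite_down_chain by auto
  then have "strict_mono f"
    using state unfolding strict_mono_Suc_iff search_state_def by blast
  then have f_ge: "k \<le> f k" for k by (rule strict_mono_imp_increasing)
  obtain M where M: "\<forall>j \<in># names (s 0). j < M"
    using finite_nat_set_iff_bounded[of "set_mset (names (s 0))"] by auto
  \<comment> \<open>Brackets of \<open>s 0\<close> were created by no instance. Their positions are
    at most \<open>M\<close>, while \<open>f k \<ge> k\<close>, so the path is beyond them from
    index \<open>Suc M\<close> on.\<close>
  define h where "h k = f (k + Suc M)" for k
  have "\<exists>n C i. box_instance C i (s (Suc n)) (s n) \<and> h k = pos_from 0 C \<and> h (Suc k) = Suc i" for k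
  proof -
    have "h (Suc k) \<notin> Suc ` set_mset (names (s 0))"
      using M f_ge[of "Suc k + Suc M"] by (force simp: h_def)
    then have "(h k, h (Suc k)) \<notin> edges_at 0 (s 0)"
      unfolding snd_edges_at[of 0, symmetric] by force
    moreover obtain n where "(h k, h (Suc k)) \<in> edges_at 0 (s n)"
      using f[of "k + Suc M"] by (auto simp: h_def)
    ultimately obtain m where m: "(h k, h (Suc k)) \<notin> edges_at 0 (s m)"
      "(h k, h (Suc k)) \<in> edges_at 0 (s (Suc m))"
      using ex_least_nat_less[of "\<lambda>n. (h k, h (Suc k)) \<in> edges_at 0 (s n)" n] by blast
    then have "adds_bracket (s m) (s (Suc m))"
      using step[of m] by (auto simp: step_def)
    with m show ?thesis unfolding adds_bracket_def by blast
  qed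
  then obtain g C i where box: "\<And>k. box_instance (C k) (i k) (s (Suc (g k))) (s (g k))"
    and pos: "\<And>k. h k = pos_from 0 (C k)" and name: "\<And>k. h (Suc k) = Suc (i k)"
    by metis
  have nested: "i k \<in> set (hole_path (C (Suc k)))" for k
    using pos_from_hole_path[of 0 "C (Suc k)"] pos[of "Suc k"] name[of k] by auto
  \<comment> \<open>The bracket \<open>i k\<close> is present in \<open>s (g (Suc k))\<close> but
    fresh for \<open>s (g k)\<close>, and names never disappear.\<close>
  have "g k < g (Suc k)" for k
  proof (rule ccontr)
    assume "\<not> g k < g (Suc k)"
    moreover obtain \<Delta> where "s (g (Suc k)) = fill (C (Suc k)) \<Delta>"
      using box[of "Suc k"] unfolding box_instance_def by blast
    then have "i k \<in># names (s (g (Suc k)))"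
      using nested[of k] hole_path_names[of "C (Suc k)" \<Delta>] by auto
    ultimately have "i k \<in># names (s (g k))"
      using names_mono[of "g (Suc k)" "g k"] by auto
    then show False
      using box[of k] unfolding box_instance_def by blast
  qed
  with box nested show ?thesis
    unfolding strict_mono_Suc_iff by blast
qed


section \<open>Proof search\<close>

primrec subforms :: "'a form \<Rightarrow> 'a form set" where
  "subforms (Atom p) = {Atom p}"
| "subforms (NegAtom p) = {NegAtom p}"
| "subforms (Conj X) = insert (Conj X) (\<Union>f \<in> rcset (cimage subforms X). f)"
| "subforms (Disj X) = insert (Disj X) (\<Union>f \<in> rcset (cimage subforms X). f)"
| "subforms (Box A) = insert (Box A) (subforms A)"
| "subforms (Dia A) = insert (Dia A) (subforms A)"

lemma subforms_refl: "A \<in> subforms A"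
  by (cases A) auto

lemma countable_subforms: "countable (subforms A)"
  by (induction A) (auto simp: cimage.rep_eq)

lemma closed_subforms: "closed (subforms A)"
proof (induction A)
  case (Conj X)
  then show ?case using subforms_refl by (fastforce simp: closed_def cimage.rep_eq)
next
  case (Disj X)
  then show ?case using subforms_refl by (fastforce simp: closed_def cimage.rep_eq)
qed (use subforms_refl in \<open>auto simp: closed_def\<close>)

lemma ex_search_state:
  assumes "nested_sequent \<Gamma>"
  obtains \<Delta> U where "erase \<Delta> = \<Gamma>" "search_state U \<Delta>" "closed U" "countable U"
proof -
  obtain \<Delta> where \<Delta>: "erase \<Delta> = \<Gamma>" "syntax_tree \<Delta>" "edges_at 0 \<Delta> \<subseteq> {(x, y). x < y}"
    using ex_syntax_tree[OF assms] .
  let ?U = "\<Union>A \<in> snd ` forms_at 0 \<Delta>. subforms A"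
  have "search_state ?U \<Delta>"
    using \<Delta> subforms_refl by (auto simp: search_state_def)
  moreover have "closed ?U"
    using closed_subforms unfolding closed_def by blast
  moreover have "countable ?U"
    using countable_finite[OF finite_forms_at] by (auto intro: countable_subforms)
  ultimately show thesis using \<Delta> that by blast
qed

text \<open>A subtree is determined by the label of its root, so siblings have distinct labels and
  \<open>label\<close> is the bijection onto the premises.\<close>

primcorec grow :: "('a tsequent \<Rightarrow> 'a tsequent cset) \<Rightarrow> 'a tsequent \<Rightarrow> 'a tree" where
  "label (grow S \<Gamma>) = \<Gamma>"
| "children (grow S \<Gamma>) = cimage (grow S) (S \<Gamma>)"

text \<open>The flag \<open>cwf\<close> separates the logics: for K and K4 both values contradict
  validity, for GL only \<open>True\<close> does.\<close>

definition refutable :: "bool \<Rightarrow> bool \<Rightarrow> 'a tsequent \<Rightarrow> bool" where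
  "refutable tr cwf \<Gamma> \<longleftrightarrow> (\<exists>F E. refutation tr F E \<and> forms_at 0 \<Gamma> \<subseteq> F \<and> edges_at 0 \<Gamma> \<subseteq> E \<and>
     (cwf \<longrightarrow> wf (E\<inverse>)))"

lemma refutableI:
  "refutation tr F E \<Longrightarrow> forms_at 0 \<Gamma> \<subseteq> F \<Longrightarrow> edges_at 0 \<Gamma> \<subseteq> E \<Longrightarrow> (cwf \<Longrightarrow> wf (E\<inverse>)) \<Longrightarrow>
    refutable tr cwf \<Gamma>"
  unfolding refutable_def by blast

lemma proof_search:
  fixes \<Gamma> :: "'a sequent"
  assumes "nested_sequent \<Gamma>"
  shows "\<exists>t. erase (label t) = \<Gamma> \<and> partial_proof_tree (rules tr) t \<and>
    (\<forall>u \<in> nodes t. rcset (children u) = {} \<longrightarrow> is_axiom (label u) \<or> refutable tr True (label t)) \<and>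
    (\<forall>b. infinite_branch t b \<longrightarrow> refutable tr (\<not> progressing_branch b) (label t))"
proof -
  obtain \<Delta> U where \<Delta>: "erase \<Delta> = \<Gamma>" "search_state U \<Delta>" and U: "closed U" "countable U"
    using ex_search_state[OF assms] .
  define Q :: "'a requirement set" where "Q = UNIV \<times> U \<times> U \<times> UNIV"
  define code where "code = to_nat_on Q"
  have "countable Q"
    using U(2) by (simp add: Q_def)
  then have inj_code: "inj_on code Q"
    unfolding code_def by (rule inj_on_to_nat_on)
  define unfulfilled where "unfulfilled \<Gamma> q \<longleftrightarrow> active (forms_at 0 \<Gamma>) (edges_at 0 \<Gamma>) q \<and>
    \<not> fulfilled tr (forms_at 0 \<Gamma>) (edges_at 0 \<Gamma>) q" for \<Gamma> :: "'a tsequent" and q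
  \<comment> \<open>\<open>code\<close> is injective only on \<open>Q\<close>, so all requirements
    met by the search must lie there.\<close>
  have unfulfilled_Q: "q \<in> Q" if "search_state U \<Gamma>" "unfulfilled \<Gamma> q" for \<Gamma> q
  proof -
    obtain w B A v where q: "q = (w, B, A, v)" by (cases q)
    with that(2) have B: "(w, B) \<in> forms_at 0 \<Gamma>" and A: "A \<in> insert B (isub B)"
      unfolding unfulfilled_def by simp_all
    have "B \<in> U"
      using that(1) imageI[OF B, of snd] unfolding search_state_def by auto
    moreover from this A have "A \<in> U" using U(1) unfolding closed_def by blast
    ultimately show ?thesis by (simp add: q Q_def)
  qed
  define least where "least \<Gamma> q \<longleftrightarrow> unfulfilled \<Gamma> q \<and>
    (\<forall>q'. unfulfilled \<Gamma> q' \<longrightarrow> code q \<le> code q')" for \<Gamma> q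
  \<comment> \<open>Stopping at axioms keeps infinite branches free of them, and hence their limits
    free of clashes.\<close>
  have "\<exists>X. if is_axiom \<Gamma> \<or> (\<forall>q. \<not> unfulfilled \<Gamma> q) then rcset X = {}
      else \<exists>q. least \<Gamma> q \<and> reduces tr U q \<Gamma> (rcset X)" if \<Gamma>: "search_state U \<Gamma>" for \<Gamma>
  proof (cases "is_axiom \<Gamma> \<or> (\<forall>q. \<not> unfulfilled \<Gamma> q)")
    case False
    then obtain q where q: "least \<Gamma> q"
      unfolding least_def using ex_has_least_nat[of "unfulfilled \<Gamma>" _ code] by blast
    then obtain P where P: "reduces tr U q \<Gamma> P"
      using ex_reduces[OF U(1) \<Gamma>] unfolding least_def unfulfilled_def by blast
    then have "rcset (acset P) = P"
      by (simp add: reduces_def)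
    with P q have "\<exists>q. least \<Gamma> q \<and> reduces tr U q \<Gamma> (rcset (acset P))"
      by metis
    with False show ?thesis by metis
  qed (auto intro: exI[of _ "acset {}"])
  then obtain S where S: "\<And>\<Gamma>. search_state U \<Gamma> \<Longrightarrow>
      if is_axiom \<Gamma> \<or> (\<forall>q. \<not> unfulfilled \<Gamma> q) then rcset (S \<Gamma>) = {}
      else \<exists>q. least \<Gamma> q \<and> reduces tr U q \<Gamma> (rcset (S \<Gamma>))"
    by metis
  have S_inner: "\<not> is_axiom \<Gamma>" "\<exists>q. least \<Gamma> q \<and> reduces tr U q \<Gamma> (rcset (S \<Gamma>))"
    if "search_state U \<Gamma>" "rcset (S \<Gamma>) \<noteq> {}" for \<Gamma>
    using S[OF that(1)] that(2) by metis+
  have S_step: "step U \<Gamma> \<Gamma>'" "\<not> is_axiom \<Gamma>"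
      "\<exists>q. least \<Gamma> q \<and> fulfilled tr (forms_at 0 \<Gamma>') (edges_at 0 \<Gamma>') q"
    if "search_state U \<Gamma>" "\<Gamma>' \<in> rcset (S \<Gamma>)" for \<Gamma> \<Gamma>'
    using S_inner[of \<Gamma>] that unfolding reduces_def by blast+
  have S_rule: "\<exists>r \<in> rules tr. rule_instance r (rcset (S \<Gamma>)) \<Gamma>"
    if "search_state U \<Gamma>" "rcset (S \<Gamma>) \<noteq> {}" for \<Gamma>
    using S_inner(2)[OF that] unfolding reduces_def by blast
  have S_leaf: "is_axiom \<Gamma> \<or> refutation tr (forms_at 0 \<Gamma>) (edges_at 0 \<Gamma>)"
    if \<Gamma>: "search_state U \<Gamma>" "rcset (S \<Gamma>) = {}" for \<Gamma>
  proof (cases "\<forall>q. \<not> unfulfilled \<Gamma> q")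
    case True
    then show ?thesis
      using is_axiom_if_clash[OF \<Gamma>(1)] unfolding refutation_def unfulfilled_def by blast
  next
    \<comment> \<open>Something is unfulfilled and yet there are no children: if the search did not
      stop at an axiom, the reducing rule itself has no premises.\<close>
    case False
    then show ?thesis
      using S[OF \<Gamma>(1)] \<Gamma>(2) is_axiom_if_no_premises by (auto simp: reduces_def split: if_splits)
  qed
  have node: "\<exists>\<Gamma>. u = grow S \<Gamma> \<and> search_state U \<Gamma> \<and> forms_at 0 \<Delta> \<subseteq> forms_at 0 \<Gamma> \<and>
      edges_at 0 \<Delta> \<subseteq> edges_at 0 \<Gamma>" if "u \<in> nodes (grow S \<Delta>)" for u
    using that
  proof induction
    case 1
    show ?case using \<Delta>(2) by blast
  next
    case (2 u v)
    then obtain \<Gamma> where \<Gamma>: "u = grow S \<Gamma>" "search_state U \<Gamma>" "forms_at 0 \<Delta> \<subseteq> forms_at 0 \<Gamma>"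
      "edges_at 0 \<Delta> \<subseteq> edges_at 0 \<Gamma>" by blast
    with 2 obtain \<Gamma>' where "v = grow S \<Gamma>'" "\<Gamma>' \<in> rcset (S \<Gamma>)"
      by (auto simp: cimage.rep_eq)
    with \<Gamma> S_step(1)[of \<Gamma> \<Gamma>'] show ?case
      unfolding step_def by blast
  qed
  show ?thesis
  proof (intro exI[of _ "grow S \<Delta>"] conjI ballI allI impI)
    show "erase (label (grow S \<Delta>)) = \<Gamma>" using \<Delta> by simp
    show "partial_proof_tree (rules tr) (grow S \<Delta>)"
      unfolding partial_proof_tree_def
    proof (intro ballI conjI impI)
      fix u assume "u \<in> nodes (grow S \<Delta>)"
      then obtain \<Gamma> where \<Gamma>: "u = grow S \<Gamma>" "search_state U \<Gamma>" using node by blast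
      then show "syntax_tree (label u)" by (simp add: search_state_def)
      assume "rcset (children u) \<noteq> {}"
      then obtain r where "r \<in> rules tr" "rule_instance r (rcset (S \<Gamma>)) \<Gamma>"
        using S_rule \<Gamma> by (auto simp: cimage.rep_eq)
      moreover have "bij_betw label (rcset (children u)) (rcset (S \<Gamma>))"
        by (auto simp: \<Gamma> cimage.rep_eq bij_betw_def inj_on_def image_image)
      ultimately show "\<exists>r \<in> rules tr. \<exists>P. rule_instance r P (label u) \<and>
          bij_betw label (rcset (children u)) P"
        using \<Gamma> by auto
    qed
  next
    fix u assume u: "u \<in> nodes (grow S \<Delta>)" "rcset (children u) = {}"
    then obtain \<Gamma> where \<Gamma>: "u = grow S \<Gamma>" "search_state U \<Gamma>" "forms_at 0 \<Delta> \<subseteq> forms_at 0 \<Gamma>"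
      "edges_at 0 \<Delta> \<subseteq> edges_at 0 \<Gamma>" using node by blast
    have "wf ((edges_at 0 \<Gamma>)\<inverse>)"
    proof (rule finite_acyclic_wf_converse)
      show "finite (edges_at 0 \<Gamma>)" by (rule finite_edges_at)
      have "acyclic {(x, y). x < (y::nat)}"
        by (rule wf_acyclic[OF wf])
      then show "acyclic (edges_at 0 \<Gamma>)"
        using \<Gamma>(2) by (auto simp: search_state_def intro: acyclic_subset)
    qed
    with u \<Gamma> S_leaf[of \<Gamma>] show "is_axiom (label u) \<or> refutable tr True (label (grow S \<Delta>))"
      by (auto simp: cimage.rep_eq intro: refutableI)
  next
    fix b assume b: "infinite_branch (grow S \<Delta>) b"
    define s where "s n = label (b n)" for n
    have b_nodes: "b n \<in> nodes (grow S \<Delta>)" for n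
      using b by (induction n) (auto simp: infinite_branch_def intro: nodes.intros)
    have b_grow: "b n = grow S (s n)" and state: "search_state U (s n)" for n
      using node[OF b_nodes[of n]] by (auto simp: s_def)
    have succ: "s (Suc n) \<in> rcset (S (s n))" for n
    proof -
      have "b (Suc n) \<in> rcset (children (b n))"
        using b by (simp add: infinite_branch_def)
      then have "b (Suc n) \<in> rcset (children (grow S (s n)))"
        by (simp only: b_grow[of n, symmetric])
      then show ?thesis by (auto simp: s_def cimage.rep_eq)
    qed
    have step: "step U (s n) (s (Suc n))" for n
      using S_step(1) state succ by blast
    let ?F = "\<Union>n. forms_at 0 (s n)" and ?E = "\<Union>n. edges_at 0 (s n)"
    have "refutation tr ?F ?E"
    proof (rule refutation_fair_run[where code = code and U = U])
      show "q = q'" if "active (forms_at 0 (s m)) (edges_at 0 (s m)) q \<and>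
          \<not> fulfilled tr (forms_at 0 (s m)) (edges_at 0 (s m)) q"
        "active (forms_at 0 (s n)) (edges_at 0 (s n)) q' \<and>
          \<not> fulfilled tr (forms_at 0 (s n)) (edges_at 0 (s n)) q'" "code q = code q'" for m n q q'
        using that inj_code unfulfilled_Q[OF state] unfolding unfulfilled_def by (blast dest: inj_onD)
      show "\<not> is_axiom (s n)" for n using S_step(2) state succ by blast
      show "\<exists>q. (active (forms_at 0 (s n)) (edges_at 0 (s n)) q \<and>
          \<not> fulfilled tr (forms_at 0 (s n)) (edges_at 0 (s n)) q) \<and>
          (\<forall>q'. active (forms_at 0 (s n)) (edges_at 0 (s n)) q' \<and>
            \<not> fulfilled tr (forms_at 0 (s n)) (edges_at 0 (s n)) q' \<longrightarrow> code q \<le> code q') \<and>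
          fulfilled tr (forms_at 0 (s (Suc n))) (edges_at 0 (s (Suc n))) q" for n
        using S_step(3)[OF state succ, of n] unfolding least_def unfulfilled_def by blast
    qed (rule state, rule step)
    moreover have "progressing_branch b \<or> wf (?E\<inverse>)"
      using progress_if_not_wf[of U s] state step unfolding progressing_branch_def s_def by blast
    moreover have "s 0 = \<Delta>"
      using b by (simp add: s_def infinite_branch_def)
    ultimately show "refutable tr (\<not> progressing_branch b) (label (grow S \<Delta>))"
      by (intro refutableI[of tr ?F ?E]) auto
  qed
qed

section \<open>Completeness of the three calculi\<close>

theorem theorem3p11:
  assumes "infinite (UNIV :: 'w set)"
  shows "complete_for (SK_provable :: 'a sequent \<Rightarrow> bool) (all_models :: ('w, 'a) kripke set) \<and>
    complete_for (SK4_provable :: 'a sequent \<Rightarrow> bool) (transitive_models :: ('w, 'a) kripke set) \<and>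
    complete_for (SGL_provable :: 'a sequent \<Rightarrow> bool) (transitive_cwf_models :: ('w, 'a) kripke set)"
proof -
  \<comment> \<open>Positions are natural numbers; this embedding carries the countermodels over to
    the given type of worlds.\<close>
  obtain \<iota> :: "nat \<Rightarrow> 'w" where \<iota>: "inj \<iota>"
    using assms infinite_countable_subset by blast
  note model = kripke_model_refutation_model[of \<iota>] supports_refutation_model[of \<iota>]
  have countermodel: "\<exists>K \<in> (all_models :: ('w, 'a) kripke set).
      supports K (erase \<Delta>) \<and> \<not> valid_in K (erase \<Delta>)"
    if "refutable False cwf \<Delta>" for cwf and \<Delta> :: "'a tsequent"
    using that refutation_not_valid[OF \<iota>] model unfolding refutable_def all_models_def by blast
  have countermodel_trans: "\<exists>K :: ('w, 'a) kripke. K \<in> transitive_models \<and>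
      supports K (erase \<Delta>) \<and> \<not> valid_in K (erase \<Delta>) \<and> (cwf \<longrightarrow> K \<in> transitive_cwf_models)"
    if R: "refutable True cwf \<Delta>" for cwf and \<Delta> :: "'a tsequent"
  proof -
    obtain F E where R: "refutation True F E" "forms_at 0 \<Delta> \<subseteq> F" "edges_at 0 \<Delta> \<subseteq> E"
      "cwf \<longrightarrow> wf (E\<inverse>)"
      using R unfolding refutable_def by blast
    let ?K = "refutation_model \<iota> F (E\<^sup>+)"
    have "trans (acc ?K)"
      using trans_map_prod[OF \<iota> trans_trancl] by simp
    moreover have "wf ((acc ?K)\<inverse>)" if "wf (E\<inverse>)"
    proof -
      \<comment> \<open>Well-foundedness survives both the transitive closure and the injective
        image.\<close>
      have "(acc ?K)\<inverse> = map_prod \<iota> \<iota> ` ((E\<inverse>)\<^sup>+)"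
        unfolding trancl_converse refutation_model_simps by force
      then show ?thesis
        using wf_map_prod_image[OF wf_trancl[OF that] \<iota>] by simp
    qed
    moreover have "\<not> valid_in ?K (erase \<Delta>)"
      using R(3) by (intro refutation_not_valid[OF \<iota> refutation_trancl[OF R(1)] R(2)]) auto
    ultimately show ?thesis
      using R(4) unfolding transitive_models_def transitive_cwf_models_def
      by (intro exI[of _ ?K]) (simp add: model)
  qed
  have "SK_provable \<Gamma>" if \<Gamma>: "nested_sequent \<Gamma>"
    "\<forall>K \<in> (all_models :: ('w, 'a) kripke set). supports K \<Gamma> \<longrightarrow> valid_in K \<Gamma>" for \<Gamma>
  proof -
    obtain t where t: "erase (label t) = \<Gamma>" "partial_proof_tree (rules False) t"
      "\<forall>u \<in> nodes t. rcset (children u) = {} \<longrightarrow> is_axiom (label u) \<or> refutable False True (label t)"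
      "\<forall>b. infinite_branch t b \<longrightarrow> refutable False (\<not> progressing_branch b) (label t)"
      using proof_search[OF \<Gamma>(1), of False] by blast
    \<comment> \<open>The value \<open>True\<close> disposes of non-axiomatic leaves, the value
      attached to a branch of every infinite branch.\<close>
    have "\<not> refutable False cwf (label t)" for cwf
      using countermodel[of cwf "label t"] \<Gamma>(2) t(1) by blast
    with t show ?thesis
      unfolding SK_provable_def axiomatic_leaves_def well_founded_tree_def rules_def if_False by blast
  qed
  moreover have "SK4_provable \<Gamma>" if \<Gamma>: "nested_sequent \<Gamma>"
    "\<forall>K \<in> (transitive_models :: ('w, 'a) kripke set). supports K \<Gamma> \<longrightarrow> valid_in K \<Gamma>" for \<Gamma>
  proof -
    obtain t where t: "erase (label t) = \<Gamma>" "partial_proof_tree (rules True) t"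
      "\<forall>u \<in> nodes t. rcset (children u) = {} \<longrightarrow> is_axiom (label u) \<or> refutable True True (label t)"
      "\<forall>b. infinite_branch t b \<longrightarrow> refutable True (\<not> progressing_branch b) (label t)"
      using proof_search[OF \<Gamma>(1), of True] by blast
    have "\<not> refutable True cwf (label t)" for cwf
      using countermodel_trans[of cwf "label t"] \<Gamma>(2) t(1) by blast
    with t show ?thesis
      unfolding SK4_provable_def axiomatic_leaves_def well_founded_tree_def rules_def if_True by blast
  qed
  moreover have "SGL_provable \<Gamma>" if \<Gamma>: "nested_sequent \<Gamma>"
    "\<forall>K \<in> (transitive_cwf_models :: ('w, 'a) kripke set). supports K \<Gamma> \<longrightarrow> valid_in K \<Gamma>" for \<Gamma>
  proof -
    obtain t where t: "erase (label t) = \<Gamma>" "partial_proof_tree (rules True) t"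
      "\<forall>u \<in> nodes t. rcset (children u) = {} \<longrightarrow> is_axiom (label u) \<or> refutable True True (label t)"
      "\<forall>b. infinite_branch t b \<longrightarrow> refutable True (\<not> progressing_branch b) (label t)"
      using proof_search[OF \<Gamma>(1), of True] by blast
    have "\<not> refutable True True (label t)"
      using countermodel_trans[of True "label t"] \<Gamma>(2) t(1) by blast
    \<comment> \<open>A non-progressing branch would set the flag in \<open>t(4)\<close> to
      \<open>True\<close>, giving the refutation just excluded.\<close>
    moreover from this have "progressing_branch b" if "infinite_branch t b" for b
      using t(4) that by (cases "progressing_branch b") auto
    ultimately show ?thesis
      using t unfolding SGL_provable_def axiomatic_leaves_def rules_def if_True by blast
  qed
  ultimately show ?thesis unfolding complete_for_def by blast
qed

end
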